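(* Let $K \ge 1$ be an integer and let $g_1, g_2, \dots, g_K$ be integers with $g_i \geq 2$ for every $i$. Then there exist distances $0 < d_1 < d_2 < \dots < d_{K+1}$ (with associated constants $\beta_1,\dots,\beta_K>0$ and $\varepsilon_2,\dots,\varepsilon_K>0$ defined in the context), Einstein radii $b_{j,\ell} > 0$ and pairwise distinct (for each fixed $j$) positions $\xi_{j,\ell} \in \mathbb{R}^2$ ($1 \le j \le K$, $1 \le \ell \le g_j$), and a source position $y \in \mathbb{R}^2$, such that the system of equations $$ \begin{cases} x_2 = x_1 - \beta_1 \alpha_1(x_1), \\ x_{i+1} = x_i + \varepsilon_i (x_i - x_{i-1}) - \beta_i \alpha_i(x_i), \quad i = 2,3,\dots,K, \end{cases} \qquad x_{K+1} := y, $$ where $$ \alpha_j(x) = \sum_{\ell=1}^{g_j} b_{j,\ell}^2\, \frac{x-\xi_{j,\ell}}{|x-\xi_{j,\ell}|^2}, $$ in the unknowns $(x_1,\dots,x_K) \in \mathbb{R}^{2K}$, is nondegenerate and has exactly $$ \prod_{i=1}^K (5 g_i - 5) $$ solutions. In other words, the corresponding $K$-plane gravitational lens, with $g_i$ point masses in the $i$-th plane, produces $\prod_{i=1}^K (5g_i-5)$ nondegenerate lensed images of a single background source.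
   Context: A $K$-plane point-mass gravitational lens consists of $K$ lens planes (copies of $\mathbb{R}^2$), at distances $0<d_1<\dots<d_K$ from the observer, with the source plane at distance $d_{K+1}>d_K$. The $j$-th plane contains $g_j$ point masses at distinct positions $\xi_{j,\ell}\in\mathbb{R}^2$ with Einstein radii $b_{j,\ell}>0$, and the source is at the fixed point $y=x_{K+1}\in\mathbb{R}^2$ of the source plane. Write $d_{i,j} = d_j - d_i$ (Euclidean geometry, or transverse comoving distances in a spatially flat universe). The constants in the lensing system are $$ \beta_i = \frac{d_{i,i+1}}{d_{i+1}} \ (1\le i\le K), \qquad \varepsilon_i = \frac{d_i\, d_{i-1,i+1}}{d_{i-1,i}\, d_{i+1}} - 1 = \frac{d_{i-1}\, d_{i,i+1}}{d_{i-1,i}\, d_{i+1}} \ (2\le i\le K). $$ When $K=1$ the system is the single equation $y = x_1 - \beta_1\alpha_1(x_1)$. A solution is a point $(x_1,\dots,x_K)\in\mathbb{R}^{2K}$ with $x_j \neq \xi_{j,\ell}$ for all $j,\ell$ that satisfies all $K$ vector equations; solutions correspond to lensed images. Moving all terms to one side, the system is $F(x_1,\dots,x_K)=0$, where $F$ is a smooth map from $\{(x_1,\dots,x_K)\in\mathbb{R}^{2K} : x_j\ne \xi_{j,\ell} \text{ for all } j,\ell\}$ to $\mathbb{R}^{2K}$. The system is nondegenerate if the Jacobian determinant of $F$ is nonzero at every solution; a single solution (image) is nondegenerate if the Jacobian determinant of $F$ is nonzero there. *)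

theory Defs
  imports "HOL-Analysis.Analysis" "Jordan_Normal_Form.Determinant"
begin

(* HOL-Analysis uses the same notation for vectors indexed by a type; here $ always means
   the component of an element of real ^ 2. *)
no_notation Matrix.vec_index (infixl "$" 100)

definition beta :: "(nat \<Rightarrow> real) \<Rightarrow> nat \<Rightarrow> real" where
  "beta d i = (d (i + 1) - d i) / d (i + 1)"

definition eps :: "(nat \<Rightarrow> real) \<Rightarrow> nat \<Rightarrow> real" where
  "eps d i = (d i * (d (i + 1) - d (i - 1))) / ((d i - d (i - 1)) * d (i + 1)) - 1"

definition alpha ::
  "nat \<Rightarrow> (nat \<Rightarrow> real) \<Rightarrow> (nat \<Rightarrow> real ^ 2) \<Rightarrow> real ^ 2 \<Rightarrow> real ^ 2" where
  "alpha m b \<xi> x = (\<Sum>l = 1..m. (b l)\<^sup>2 *\<^sub>R ((x - \<xi> l) /\<^sub>R (norm (x - \<xi> l))\<^sup>2))"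

(* The right-hand side of the i-th lens equation. The value of x at 0 is never used. *)
definition ray ::
  "(nat \<Rightarrow> nat) \<Rightarrow> (nat \<Rightarrow> real) \<Rightarrow> (nat \<Rightarrow> nat \<Rightarrow> real) \<Rightarrow> (nat \<Rightarrow> nat \<Rightarrow> real ^ 2)
    \<Rightarrow> (nat \<Rightarrow> real ^ 2) \<Rightarrow> nat \<Rightarrow> real ^ 2" where
  "ray g d b \<xi> x i =
    (if i = 1 then x 1 - beta d 1 *\<^sub>R alpha (g 1) (b 1) (\<xi> 1) (x 1)
     else x i + eps d i *\<^sub>R (x i - x (i - 1)) - beta d i *\<^sub>R alpha (g i) (b i) (\<xi> i) (x i))"

(* A point (x_1, ..., x_K) of (R^2)^K is an extensional function on {1..K}, so that distinct
   functions are distinct points. *)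
definition lens_domain ::
  "nat \<Rightarrow> (nat \<Rightarrow> nat) \<Rightarrow> (nat \<Rightarrow> nat \<Rightarrow> real ^ 2) \<Rightarrow> (nat \<Rightarrow> real ^ 2) set" where
  "lens_domain K g \<xi> =
    {x \<in> {1..K} \<rightarrow>\<^sub>E UNIV. \<forall>j\<in>{1..K}. \<forall>l\<in>{1..g j}. x j \<noteq> \<xi> j l}"

(* The update x(K + 1 := y) encodes the convention x_{K+1} = y. *)
definition lens_solutions ::
  "nat \<Rightarrow> (nat \<Rightarrow> nat) \<Rightarrow> (nat \<Rightarrow> real) \<Rightarrow> (nat \<Rightarrow> nat \<Rightarrow> real) \<Rightarrow> (nat \<Rightarrow> nat \<Rightarrow> real ^ 2)
    \<Rightarrow> real ^ 2 \<Rightarrow> (nat \<Rightarrow> real ^ 2) set" where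
  "lens_solutions K g d b \<xi> y =
    {x \<in> lens_domain K g \<xi>. \<forall>i\<in>{1..K}. (x(K + 1 := y)) (i + 1) = ray g d b \<xi> x i}"

definition lens_map ::
  "nat \<Rightarrow> (nat \<Rightarrow> nat) \<Rightarrow> (nat \<Rightarrow> real) \<Rightarrow> (nat \<Rightarrow> nat \<Rightarrow> real) \<Rightarrow> (nat \<Rightarrow> nat \<Rightarrow> real ^ 2)
    \<Rightarrow> real ^ 2 \<Rightarrow> (nat \<Rightarrow> real ^ 2) \<Rightarrow> nat \<Rightarrow> real ^ 2" where
  "lens_map K g d b \<xi> y x = (\<lambda>i\<in>{1..K}. (x(K + 1 := y)) (i + 1) - ray g d b \<xi> x i)"

(* The 2K real coordinates of (x_1, ..., x_K), numbered from 0: number c is component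
   c mod 2 + 1 of x_{c div 2 + 1}. The index 2 of type 2 equals 0, hence of_nat. *)
definition coord :: "(nat \<Rightarrow> real ^ 2) \<Rightarrow> nat \<Rightarrow> real" where
  "coord x c = x (c div 2 + 1) $ of_nat (c mod 2 + 1)"

definition shift_coord :: "(nat \<Rightarrow> real ^ 2) \<Rightarrow> nat \<Rightarrow> real \<Rightarrow> nat \<Rightarrow> real ^ 2" where
  "shift_coord x c t =
    x(c div 2 + 1 := x (c div 2 + 1) + t *\<^sub>R axis (of_nat (c mod 2 + 1)) 1)"

(* The matrix of partial derivatives at x of a map from (R^2)^K to itself: entry (r, c) is the
   derivative of output coordinate r along input coordinate c. *)
definition jacobian_matrix ::
  "nat \<Rightarrow> ((nat \<Rightarrow> real ^ 2) \<Rightarrow> nat \<Rightarrow> real ^ 2) \<Rightarrow> (nat \<Rightarrow> real ^ 2) \<Rightarrow> real Matrix.mat" where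
  "jacobian_matrix K F x =
    Matrix.mat (2 * K) (2 * K) (\<lambda>(r, c). deriv (\<lambda>t. coord (F (shift_coord x c t)) r) 0)"

definition nondegenerate ::
  "nat \<Rightarrow> (nat \<Rightarrow> nat) \<Rightarrow> (nat \<Rightarrow> real) \<Rightarrow> (nat \<Rightarrow> nat \<Rightarrow> real) \<Rightarrow> (nat \<Rightarrow> nat \<Rightarrow> real ^ 2)
    \<Rightarrow> real ^ 2 \<Rightarrow> bool" where
  "nondegenerate K g d b \<xi> y \<longleftrightarrow>
    (\<forall>x\<in>lens_solutions K g d b \<xi> y.
      Determinant.det (jacobian_matrix K (lens_map K g d b \<xi> y) x) \<noteq> 0)"

lemma eps_altdef:
  assumes "d (i - 1) \<noteq> d i" "d (i + 1) \<noteq> 0"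
  shows "eps d i = (d (i - 1) * (d (i + 1) - d i)) / ((d i - d (i - 1)) * d (i + 1))"
  using assms unfolding eps_def by (simp add: divide_simps) (simp add: algebra_simps)

lemma lens_solutions_iff_lens_map:
  "x \<in> lens_solutions K g d b \<xi> y \<longleftrightarrow>
    x \<in> lens_domain K g \<xi> \<and> lens_map K g d b \<xi> y x = (\<lambda>i\<in>{1..K}. 0)"
  by (auto simp: lens_solutions_def lens_map_def fun_eq_iff restrict_def)

end

theory Submission
  imports Defs
begin

text \<open>
  A ray is determined by its first point \<open>p = x\<^sub>1\<close>, so the images are the preimages of \<open>y\<close> under the
  map \<open>p \<mapsto> x\<^sub>K\<^sub>+\<^sub>1\<close>. By induction on the number of planes, this map has exactly the right
  number of preimages, all regular, over every point of some disc around the origin. A new plane is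
  added on the source side. Its masses come from a single-plane lens with \<open>5 g - 5\<close> regular images of
  the origin, shrunk until all these images lie in the disc; with the coupling
  \<open>\<epsilon>\<close> to the plane before set to 0 the numbers of preimages multiply. They do not change
  under a small perturbation of \<open>\<epsilon>\<close> and \<open>y\<close>, by the inverse function theorem near each preimage and
  by a compactness argument elsewhere.

  The single-plane lens has equal masses at the \<open>n\<close>-th roots of unity, with \<open>n = g\<close> for \<open>g \<le> 3\<close>;
  for \<open>g \<ge> 4\<close> it is Rhie's lens, with \<open>n = g - 1\<close> and a small mass at the centre. By symmetry its
  equation reduces to one for \<open>|z|\<close> whose roots are counted with Rolle's theorem.
\<close>

section \<open>Regular fibres and their perturbation\<close>

text \<open>At zero coupling the product count is immediate, but actual distances force \<epsilon> >
  0, so an exact count must survive a perturbation. The obstacle is the upper bound: new images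
  could come in from infinity or emerge from the masses. \<open>lens_like\<close> and
  \<open>controlled\<close> exclude both uniformly for couplings up to 1/8, a bound under which the
  growth estimate reproduces itself from plane to plane. A whole disc of regular values is carried
  along because the next lens has many zeros, and the earlier planes must be counted over each of
  them. Distances are fitted last; the \<beta>'s are then absorbed into the Einstein radii.

  The small cases are separate because a ring of n equal masses has at most 3 n + 1 images, which
  reaches 5 n - 5 only for n \<le> 3. With a centre mass there are 5 n images for small \<epsilon>
  from n = 3 on, but for n = 2 only 6 instead of the 10 wanted. Total ring mass 2 makes t = 1 a
  radius for \<sigma> = -1 and \<epsilon> = 0, so the equations for n = 2, 3 can be solved
  explicitly.\<close>

definition C1_on :: "'a::euclidean_space set \<Rightarrow> ('a \<Rightarrow> 'b::euclidean_space) \<Rightarrow> bool" where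
  "C1_on U f \<longleftrightarrow> (\<exists>F. (\<forall>x\<in>U. (f has_derivative F x) (at x)) \<and> (\<forall>v. continuous_on U (\<lambda>x. F x v)))"

text \<open>For equal dimensions this is the nonvanishing of the Jacobian determinant, in a form
  that composes without coordinates.\<close>

definition regular_at :: "('a::euclidean_space \<Rightarrow> 'b::euclidean_space) \<Rightarrow> 'a \<Rightarrow> bool" where
  "regular_at f x \<longleftrightarrow> (\<exists>L. (f has_derivative L) (at x) \<and> inj L)"

definition regular_fibre ::
  "'a::euclidean_space set \<Rightarrow> ('a \<Rightarrow> 'b::euclidean_space) \<Rightarrow> 'b \<Rightarrow> nat \<Rightarrow> bool" where
  "regular_fibre D f y N \<longleftrightarrow>
    finite {x\<in>D. f x = y} \<and> card {x\<in>D. f x = y} = N \<and> (\<forall>x\<in>D. f x = y \<longrightarrow> regular_at f x)"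

lemma C1_onI:
  assumes "\<And>x. x \<in> U \<Longrightarrow> (f has_derivative F x) (at x)" "\<And>v. continuous_on U (\<lambda>x. F x v)"
  shows "C1_on U f"
  using assms unfolding C1_on_def by blast

text \<open>Continuity along each fixed vector is easy to check, but the inverse function theorem
  needs continuity in operator norm. In finite dimension the basis vectors suffice for that.\<close>

lemma C1_on_blinfunE:
  assumes "C1_on U f"
  obtains F where "\<And>x. x \<in> U \<Longrightarrow> (f has_derivative blinfun_apply (F x)) (at x)" "continuous_on U F"
proof -
  obtain F where F: "\<And>x. x \<in> U \<Longrightarrow> (f has_derivative F x) (at x)"
    and cont: "\<And>v. continuous_on U (\<lambda>x. F x v)"
    using assms unfolding C1_on_def by blast
  have eq: "blinfun_apply (Blinfun (F x)) = F x" if "x \<in> U" for x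
    using F[OF that] bounded_linear_Blinfun_apply has_derivative_bounded_linear by blast
  show thesis
  proof (rule that[of "\<lambda>x. Blinfun (F x)"])
    show "(f has_derivative blinfun_apply (Blinfun (F x))) (at x)" if "x \<in> U" for x
      using F[OF that] eq[OF that] by simp
    show "continuous_on U (\<lambda>x. Blinfun (F x))"
    proof (rule continuous_on_blinfun_componentwise)
      fix i :: 'a
      show "continuous_on U (\<lambda>x. blinfun_apply (Blinfun (F x)) i)"
        using cont[of i] by (rule continuous_on_eq) (simp add: eq)
    qed
  qed
qed

lemma C1_on_imp_continuous_on: "C1_on U f \<Longrightarrow> continuous_on U f"
  unfolding C1_on_def
  by (meson continuous_at_imp_continuous_on has_derivative_continuous)

lemma C1_on_imp_has_derivative:
  "C1_on U f \<Longrightarrow> x \<in> U \<Longrightarrow> \<exists>F. (f has_derivative F) (at x)"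
  unfolding C1_on_def by blast

lemma C1_on_subset: "C1_on U f \<Longrightarrow> V \<subseteq> U \<Longrightarrow> C1_on V f"
  unfolding C1_on_def by (meson continuous_on_subset subsetD)

lemma C1_on_bounded_linear: "bounded_linear f \<Longrightarrow> C1_on U f"
  by (rule C1_onI[of _ _ "\<lambda>_. f"]) (auto simp: bounded_linear_imp_has_derivative)

lemma C1_on_const: "C1_on U (\<lambda>_. c)"
  by (rule C1_onI[of _ _ "\<lambda>_ _. 0"]) auto

lemma C1_on_add: "C1_on U f \<Longrightarrow> C1_on U g \<Longrightarrow> C1_on U (\<lambda>x. f x + g x)"
  unfolding C1_on_def
proof (elim exE conjE)
  fix F G
  assume "\<forall>x\<in>U. (f has_derivative F x) (at x)" "\<forall>v. continuous_on U (\<lambda>x. F x v)"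
    "\<forall>x\<in>U. (g has_derivative G x) (at x)" "\<forall>v. continuous_on U (\<lambda>x. G x v)"
  then show "\<exists>F. (\<forall>x\<in>U. ((\<lambda>x. f x + g x) has_derivative F x) (at x)) \<and>
    (\<forall>v. continuous_on U (\<lambda>x. F x v))"
    by (intro exI[of _ "\<lambda>x v. F x v + G x v"])
      (auto intro!: continuous_intros derivative_intros)
qed

lemma C1_on_scaleR:
  assumes "C1_on U f" "C1_on U g"
  shows "C1_on U (\<lambda>x. f x *\<^sub>R g x)"
proof -
  note cont = assms[THEN C1_on_imp_continuous_on]
  obtain F G where "\<forall>x\<in>U. (f has_derivative F x) (at x)" "\<forall>v. continuous_on U (\<lambda>x. F x v)"
    "\<forall>x\<in>U. (g has_derivative G x) (at x)" "\<forall>v. continuous_on U (\<lambda>x. G x v)"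
    using assms unfolding C1_on_def by blast
  with cont show ?thesis
    by (intro C1_onI[of _ _ "\<lambda>x v. f x *\<^sub>R G x v + F x v *\<^sub>R g x"])
      (auto intro!: continuous_intros derivative_intros)
qed

lemma C1_on_diff: "C1_on U f \<Longrightarrow> C1_on U g \<Longrightarrow> C1_on U (\<lambda>x. f x - g x)"
  using C1_on_add[OF _ C1_on_scaleR[OF C1_on_const, of U g "-1"], of f] by simp

lemma C1_on_sum: "(\<And>i. i \<in> I \<Longrightarrow> C1_on U (f i)) \<Longrightarrow> C1_on U (\<lambda>x. \<Sum>i\<in>I. f i x)"
  by (induction I rule: infinite_finite_induct) (auto intro: C1_on_const C1_on_add)

text \<open>In the chain rule both the operator and its argument vary with the point, so continuity
  for fixed vectors is first upgraded to operator norm.\<close>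

lemma C1_on_compose:
  assumes f: "C1_on V f" and g: "C1_on U g" and sub: "g ` U \<subseteq> V"
  shows "C1_on U (\<lambda>x. f (g x))"
proof -
  obtain F where F: "\<And>x. x \<in> V \<Longrightarrow> (f has_derivative blinfun_apply (F x)) (at x)"
      "continuous_on V F"
    by (rule C1_on_blinfunE[OF f]) blast
  obtain G where G: "\<And>x. x \<in> U \<Longrightarrow> (g has_derivative blinfun_apply (G x)) (at x)"
      "continuous_on U G"
    by (rule C1_on_blinfunE[OF g]) blast
  show ?thesis
  proof (rule C1_onI)
    show "((\<lambda>x. f (g x)) has_derivative (\<lambda>v. F (g x) (G x v))) (at x)" if "x \<in> U" for x
      using has_derivative_compose[OF G(1)[OF that] F(1)] sub that by auto
    have "continuous_on U (\<lambda>x. F (g x))"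
      using continuous_on_compose2[OF F(2) C1_on_imp_continuous_on[OF g] sub] .
    then show "continuous_on U (\<lambda>x. F (g x) (G x v))" for v
      by (intro continuous_intros G(2))
  qed
qed

lemma regular_at_compose:
  assumes "regular_at f (g x)" "regular_at g x"
  shows "regular_at (\<lambda>x. f (g x)) x"
proof -
  obtain F G where "(f has_derivative F) (at (g x))" "inj F" "(g has_derivative G) (at x)" "inj G"
    using assms unfolding regular_at_def by blast
  then have "((\<lambda>x. f (g x)) has_derivative (\<lambda>v. F (G v))) (at x)" "inj (\<lambda>v. F (G v))"
    using has_derivative_compose inj_compose[of F G] by (auto simp: o_def)
  then show ?thesis
    unfolding regular_at_def by blast
qed

section \<open>Persistence of simple zeros under a change of parameters\<close>

lemma finite_imp_separated:
  fixes Z :: "'a::metric_space set"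
  assumes "finite Z"
  obtains \<rho> where "\<rho> > 0" "\<And>x y. x \<in> Z \<Longrightarrow> y \<in> Z \<Longrightarrow> x \<noteq> y \<Longrightarrow> ball x \<rho> \<inter> ball y \<rho> = {}"
proof -
  define S where "S = insert 1 ((\<lambda>(x, y). dist x y / 2) ` {(x, y). x \<in> Z \<and> y \<in> Z \<and> x \<noteq> y})"
  have "finite {(x, y). x \<in> Z \<and> y \<in> Z \<and> x \<noteq> y}"
    by (rule finite_subset[of _ "Z \<times> Z"]) (use assms in auto)
  then have fin: "finite S" "S \<noteq> {}" "\<forall>s\<in>S. s > 0"
    unfolding S_def by auto
  show thesis
  proof (rule that[of "Min S"])
    show "Min S > 0"
      using fin by simp
    fix x y assume xy: "x \<in> Z" "y \<in> Z" "x \<noteq> y"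
    then have "Min S \<le> dist x y / 2"
      using fin(1) by (intro Min_le) (auto simp: S_def)
    then show "ball x (Min S) \<inter> ball y (Min S) = {}"
      by (intro disjoint_ballI) auto
  qed
qed

text \<open>The inverse function theorem is applied to \<open>H\<close>, which sends (p, x) to (p, G
  (p, x)). Its derivative is block triangular, hence injective once the partial derivative in x is.
  The homeomorphism gives one zero for each nearby p; bijectivity of the derivative on all of
  \<open>U\<close> makes that zero regular.\<close>

lemma local_implicit_solution:
  fixes G :: "'p::euclidean_space \<times> 'a::euclidean_space \<Rightarrow> 'a"
  assumes D: "open D" and C1: "C1_on (UNIV \<times> D) G" and x: "x \<in> D" "G (p0, x) = 0"
    and reg: "regular_at (\<lambda>x. G (p0, x)) x"
  shows "\<exists>U. open U \<and> (p0, x) \<in> U \<and> U \<subseteq> UNIV \<times> D \<and>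
    (\<forall>\<^sub>F p in nhds p0. \<exists>!x. (p, x) \<in> U \<and> G (p, x) = 0) \<and>
    (\<forall>p x. (p, x) \<in> U \<longrightarrow> regular_at (\<lambda>x. G (p, x)) x)"
proof -
  obtain G' where G': "\<And>z. z \<in> UNIV \<times> D \<Longrightarrow> (G has_derivative blinfun_apply (G' z)) (at z)"
    "continuous_on (UNIV \<times> D) G'"
    by (rule C1_on_blinfunE[OF C1]) blast
  have partial: "((\<lambda>x. G (p, x)) has_derivative (\<lambda>v. G' (p, x) (0, v))) (at x)" if "x \<in> D" for p x
  proof -
    have "(Pair p has_derivative (\<lambda>v. (0, v))) (at x)"
      by (auto intro!: derivative_eq_intros)
    from has_derivative_compose[OF this, of G "G' (p, x)"] show ?thesis
      using G'(1)[of "(p, x)"] that by auto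
  qed
  define H where "H = (\<lambda>z. (fst z, G z))"
  have "C1_on (UNIV \<times> D) H"
  proof (rule C1_onI)
    show "(H has_derivative (\<lambda>v. (fst v, G' z v))) (at z)" if "z \<in> UNIV \<times> D" for z
      unfolding H_def using G'(1)[OF that] by (auto intro!: derivative_eq_intros)
    show "continuous_on (UNIV \<times> D) (\<lambda>z. (fst v, G' z v))" for v
      by (intro continuous_intros G'(2))
  qed
  then obtain H' where H': "\<And>z. z \<in> UNIV \<times> D \<Longrightarrow> (H has_derivative blinfun_apply (H' z)) (at z)"
      "continuous_on (UNIV \<times> D) H'"
    by (rule C1_on_blinfunE) blast
  have H'_eq: "H' z v = (fst v, G' z v)" if "z \<in> UNIV \<times> D" for z v
  proof -
    have "(H has_derivative (\<lambda>v. (fst v, G' z v))) (at z)"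
      unfolding H_def using G'(1)[OF that] by (auto intro!: derivative_eq_intros)
    then show ?thesis
      using has_derivative_unique[OF H'(1)[OF that]] by metis
  qed
  obtain L where L: "((\<lambda>x. G (p0, x)) has_derivative L) (at x)" "inj L"
    using reg unfolding regular_at_def by blast
  have L_eq: "L = (\<lambda>v. G' (p0, x) (0, v))"
    using has_derivative_unique[OF L(1) partial[OF x(1)]] .
  have "inj (blinfun_apply (H' (p0, x)))"
  proof (rule injI)
    fix u v assume "H' (p0, x) u = H' (p0, x) v"
    then have uv: "fst u = fst v" "G' (p0, x) u = G' (p0, x) v"
      using x(1) by (auto simp: H'_eq)
    have "G' (p0, x) (u - v) = 0"
      using uv(2) by (simp add: blinfun.diff_right)
    moreover have "u - v = (0, snd u - snd v)"
      using uv(1) by (simp add: prod_eq_iff)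
    ultimately have "L (snd u - snd v) = L 0"
      by (simp add: L_eq zero_prod_def[symmetric] blinfun.zero_right)
    then have "snd u = snd v"
      using injD[OF L(2)] by fastforce
    with uv(1) show "u = v"
      by (simp add: prod_eq_iff)
  qed
  then obtain M where M: "linear M" "M \<circ> blinfun_apply (H' (p0, x)) = id"
    using linear_injective_left_inverse[of "blinfun_apply (H' (p0, x))"]
      bounded_linear.linear[OF blinfun.bounded_linear_right] by blast
  \<comment> \<open>\<open>inverse_function_theorem\<close> takes invertibility in the form of a
    one-sided inverse among bounded linear functions.\<close>
  have "Blinfun M o\<^sub>L H' (p0, x) = id_blinfun"
    using fun_cong[OF M(2)] by (intro blinfun_eqI)
      (simp add: bounded_linear_Blinfun_apply[OF linear_conv_bounded_linear[THEN iffD1, OF M(1)]])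
  then obtain U V g g' where U: "open U" "U \<subseteq> UNIV \<times> D" "(p0, x) \<in> U"
    and V: "open V" "H (p0, x) \<in> V"
    and hom: "homeomorphism U V H g" and bij: "\<And>y. y \<in> V \<Longrightarrow> bij (blinfun_apply (H' (g y)))"
    using inverse_function_theorem[OF open_Times[OF open_UNIV D] H', of "(p0, x)"] x(1)
    by (metis SigmaI UNIV_I)
  have ev: "\<forall>\<^sub>F p in nhds p0. (p, 0) \<in> V"
  proof -
    have "open ((\<lambda>p. (p, 0 :: 'a)) -` V)"
      using V(1) by (intro open_vimage continuous_intros)
    moreover have "p0 \<in> (\<lambda>p. (p, 0 :: 'a)) -` V"
      using V(2) x(2) by (simp add: H_def)
    ultimately show ?thesis
      unfolding eventually_nhds by blast
  qed
  have "\<forall>\<^sub>F p in nhds p0. \<exists>!x. (p, x) \<in> U \<and> G (p, x) = 0"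
    using ev
  proof eventually_elim
    case (elim p)
    have g: "g (p, 0) \<in> U" "H (g (p, 0)) = (p, 0)"
      using hom elim unfolding homeomorphism_def by auto
    then have eq: "g (p, 0) = (p, snd (g (p, 0)))"
      by (metis H_def Pair_inject prod.collapse)
    show ?case
    proof (rule ex1I[of _ "snd (g (p, 0))"])
      show "(p, snd (g (p, 0))) \<in> U \<and> G (p, snd (g (p, 0))) = 0"
        using g eq by (metis H_def Pair_inject)
      fix x assume "(p, x) \<in> U \<and> G (p, x) = 0"
      then have "g (H (p, x)) = (p, x)" "H (p, x) = (p, 0)"
        using hom unfolding homeomorphism_def H_def by auto
      then show "x = snd (g (p, 0))"
        by simp
    qed
  qed
  moreover have "regular_at (\<lambda>x. G (p, x)) x" if "(p, x) \<in> U" for p x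
  proof -
    have "H (p, x) \<in> V" "g (H (p, x)) = (p, x)"
      using that hom unfolding homeomorphism_def by auto
    then have inj: "inj (blinfun_apply (H' (p, x)))"
      using bij bij_is_inj by metis
    have "inj (\<lambda>v. G' (p, x) (0, v))"
    proof (rule injI)
      fix u v assume "G' (p, x) (0, u) = G' (p, x) (0, v)"
      then have "H' (p, x) (0, u) = H' (p, x) (0, v)"
        using U(2) that by (auto simp: H'_eq)
      then show "u = v"
        using injD[OF inj] by blast
    qed
    then show ?thesis
      using partial U(2) that unfolding regular_at_def by blast
  qed
  ultimately show ?thesis
    using U by blast
qed

text \<open>Each zero continues uniquely near itself, and the compact set \<open>C\<close>, common
  to all nearby parameters, leaves no room for further zeros to appear elsewhere.\<close>

lemma regular_fibre_perturb:
  fixes G :: "'p::euclidean_space \<times> 'a::euclidean_space \<Rightarrow> 'a"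
  assumes D: "open D" and C1: "C1_on (UNIV \<times> D) G"
    and C: "compact C" "C \<subseteq> D" and r: "r > 0"
    and bound: "\<And>p x. dist p0 p \<le> r \<Longrightarrow> x \<in> D \<Longrightarrow> G (p, x) = 0 \<Longrightarrow> x \<in> C"
    and fib: "regular_fibre D (\<lambda>x. G (p0, x)) 0 N"
  shows "\<forall>\<^sub>F p in nhds p0. regular_fibre D (\<lambda>x. G (p, x)) 0 N"
proof -
  define Z where "Z = {x\<in>D. G (p0, x) = 0}"
  have Z: "finite Z" "card Z = N" and reg: "\<And>x. x \<in> Z \<Longrightarrow> regular_at (\<lambda>x. G (p0, x)) x"
    using fib unfolding regular_fibre_def Z_def by auto
  obtain \<rho> where \<rho>: "\<rho> > 0" "\<And>x y. x \<in> Z \<Longrightarrow> y \<in> Z \<Longrightarrow> x \<noteq> y \<Longrightarrow> ball x \<rho> \<inter> ball y \<rho> = {}"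
    using finite_imp_separated[OF Z(1)] by blast
  \<comment> \<open>Cutting \<open>D\<close> down to disjoint balls keeps the continuations of
    different zeros different.\<close>
  have "\<forall>x\<in>Z. \<exists>U. open U \<and> (p0, x) \<in> U \<and> U \<subseteq> UNIV \<times> (D \<inter> ball x \<rho>) \<and>
    (\<forall>\<^sub>F p in nhds p0. \<exists>!x. (p, x) \<in> U \<and> G (p, x) = 0) \<and>
    (\<forall>p x. (p, x) \<in> U \<longrightarrow> regular_at (\<lambda>x. G (p, x)) x)"
  proof
    fix x assume "x \<in> Z"
    then show "\<exists>U. open U \<and> (p0, x) \<in> U \<and> U \<subseteq> UNIV \<times> (D \<inter> ball x \<rho>) \<and>
      (\<forall>\<^sub>F p in nhds p0. \<exists>!x. (p, x) \<in> U \<and> G (p, x) = 0) \<and>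
      (\<forall>p x. (p, x) \<in> U \<longrightarrow> regular_at (\<lambda>x. G (p, x)) x)"
      using D \<rho>(1) reg by (intro local_implicit_solution C1_on_subset[OF C1]) (auto simp: Z_def)
  qed
  from bchoice[OF this] obtain U where *: "\<forall>x\<in>Z. open (U x) \<and> (p0, x) \<in> U x \<and>
    U x \<subseteq> UNIV \<times> (D \<inter> ball x \<rho>) \<and>
    (\<forall>\<^sub>F p in nhds p0. \<exists>!x'. (p, x') \<in> U x \<and> G (p, x') = 0) \<and>
    (\<forall>p x'. (p, x') \<in> U x \<longrightarrow> regular_at (\<lambda>x. G (p, x)) x')" ..
  have U: "open (U x)" "(p0, x) \<in> U x" "U x \<subseteq> UNIV \<times> (D \<inter> ball x \<rho>)"
    and ex1: "\<forall>\<^sub>F p in nhds p0. \<exists>!x'. (p, x') \<in> U x \<and> G (p, x') = 0"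
    and regU: "\<And>p x'. (p, x') \<in> U x \<Longrightarrow> regular_at (\<lambda>x. G (p, x)) x'" if "x \<in> Z" for x
    using bspec[OF * that] by simp_all
  \<comment> \<open>\<open>B\<close> holds the zeros that no neighbourhood \<open>U x\<close>
    accounts for. It is compact, so the parameters at which such zeros occur form a closed set, and
    \<open>p0\<close> is not among them.\<close>
  define B where "B = {z \<in> cball p0 r \<times> C. G z = 0} - (\<Union>x\<in>Z. U x)"
  have "continuous_on (cball p0 r \<times> C) G"
    using C1_on_imp_continuous_on[OF C1] by (rule continuous_on_subset) (use C(2) in auto)
  then have "closed {z \<in> cball p0 r \<times> C. G z = 0}"
    using C(1) by (intro continuous_closed_preimage_constant closed_Times compact_imp_closed) auto
  then have "closed B"
    unfolding B_def using U(1) by (intro closed_Diff open_UN) auto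
  moreover have "bounded B"
    using compact_Times[OF compact_cball C(1), THEN compact_imp_bounded]
    by (rule bounded_subset) (auto simp: B_def)
  ultimately have "compact B"
    by (simp add: compact_eq_bounded_closed)
  then have "closed (fst ` B)"
    by (intro compact_imp_closed compact_continuous_image continuous_intros)
  moreover have "p0 \<notin> fst ` B"
  proof
    assume "p0 \<in> fst ` B"
    then obtain x where x: "(p0, x) \<in> B"
      by force
    then have "x \<in> Z"
      using C(2) by (auto simp: B_def Z_def)
    with x U(2) show False
      by (auto simp: B_def)
  qed
  ultimately have ev1: "\<forall>\<^sub>F p in nhds p0. p \<notin> fst ` B"
    using eventually_nhds_in_open[of "- fst ` B" p0] by (simp add: open_Compl)
  have ev2: "\<forall>\<^sub>F p in nhds p0. p \<in> cball p0 r"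
    using eventually_nhds_in_open[of "ball p0 r" p0] r by (auto elim: eventually_mono)
  have ev3: "\<forall>\<^sub>F p in nhds p0. \<forall>x\<in>Z. \<exists>!x'. (p, x') \<in> U x \<and> G (p, x') = 0"
    using ex1 Z(1) by (intro eventually_ball_finite) auto
  show ?thesis
    using ev1 ev2 ev3
  proof eventually_elim
    case (elim p)
    obtain s where s: "\<And>x. x \<in> Z \<Longrightarrow> (p, s x) \<in> U x" "\<And>x. x \<in> Z \<Longrightarrow> G (p, s x) = 0"
      and s_unique: "\<And>x x'. x \<in> Z \<Longrightarrow> (p, x') \<in> U x \<Longrightarrow> G (p, x') = 0 \<Longrightarrow> x' = s x"
    proof -
      from elim(3) have "\<forall>x\<in>Z. \<exists>y. ((p, y) \<in> U x \<and> G (p, y) = 0) \<and>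
        (\<forall>x'. (p, x') \<in> U x \<and> G (p, x') = 0 \<longrightarrow> x' = y)"
        unfolding Ex1_def .
      from bchoice[OF this] show thesis
        using that by auto
    qed
    have covered: "\<exists>x\<in>Z. x' = s x" if x': "x' \<in> D" "G (p, x') = 0" for x'
    proof -
      have "(p, x') \<notin> B"
        using elim(1) by force
      moreover have "(p, x') \<in> cball p0 r \<times> C"
        using elim(2) bound[of p x'] that by auto
      ultimately obtain x where "x \<in> Z" "(p, x') \<in> U x"
        using x' by (auto simp: B_def)
      then show ?thesis
        using s_unique x'(2) by blast
    qed
    have inj: "inj_on s Z"
    proof (rule inj_onI, rule ccontr)
      fix x y assume "x \<in> Z" "y \<in> Z" "s x = s y" "x \<noteq> y"
      then show False
        using s(1)[of x] s(1)[of y] U(3)[of x] U(3)[of y] \<rho>(2)[of x y] by auto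
    qed
    have eq: "{x\<in>D. G (p, x) = 0} = s ` Z"
      using covered s U(3) by blast
    show ?case
      unfolding regular_fibre_def eq
    proof (intro conjI ballI impI)
      show "finite (s ` Z)" "card (s ` Z) = N"
        using Z inj by (auto simp: card_image)
      fix x assume "x \<in> D" "G (p, x) = 0"
      then obtain z where "z \<in> Z" "x = s z"
        using covered by blast
      then show "regular_at (\<lambda>x. G (p, x)) x"
        using regU s(1) by blast
    qed
  qed
qed

section \<open>Adding a lens plane\<close>

lemma regular_at_add_const: "regular_at (\<lambda>x. f x + c) x \<longleftrightarrow> regular_at f x"
proof -
  have "((\<lambda>x. f x + c) has_derivative L) (at x) \<longleftrightarrow> (f has_derivative L) (at x)" for L
    using has_derivative_add_const[of f L "at x" c]
      has_derivative_add_const[of "\<lambda>x. f x + c" L "at x" "-c"] by auto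
  then show ?thesis
    unfolding regular_at_def by simp
qed

lemma regular_fibre_diff_const: "regular_fibre D (\<lambda>x. f x - c) 0 N \<longleftrightarrow> regular_fibre D f c N"
  using regular_at_add_const[of f "-c"] unfolding regular_fibre_def by simp

text \<open>The fibre of the composition is the disjoint union of the fibres of \<open>g\<close>
  over the \<open>N\<close> points of the fibre of \<open>f\<close>; regularity is the chain
  rule.\<close>

lemma regular_fibre_compose:
  assumes f: "regular_fibre E f y N" and g: "\<And>z. z \<in> E \<Longrightarrow> f z = y \<Longrightarrow> regular_fibre D g z M"
  shows "regular_fibre {x\<in>D. g x \<in> E} (\<lambda>x. f (g x)) y (N * M)"
proof -
  define Z where "Z = {z\<in>E. f z = y}"
  have Z: "finite Z" "card Z = N" "\<And>z. z \<in> Z \<Longrightarrow> regular_at f z"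
    using f unfolding regular_fibre_def Z_def by auto
  have g': "\<And>z. z \<in> Z \<Longrightarrow> finite {x\<in>D. g x = z}" "\<And>z. z \<in> Z \<Longrightarrow> card {x\<in>D. g x = z} = M"
    using g unfolding regular_fibre_def Z_def by auto
  have eq: "{x\<in>{x\<in>D. g x \<in> E}. f (g x) = y} = (\<Union>z\<in>Z. {x\<in>D. g x = z})"
    unfolding Z_def by auto
  show ?thesis
    unfolding regular_fibre_def eq
  proof (intro conjI ballI impI)
    show "finite (\<Union>z\<in>Z. {x\<in>D. g x = z})"
      using Z(1) g'(1) by blast
    have "card (\<Union>z\<in>Z. {x\<in>D. g x = z}) = (\<Sum>z\<in>Z. card {x\<in>D. g x = z})"
      using Z(1) g'(1) by (intro card_UN_disjoint) auto
    then show "card (\<Union>z\<in>Z. {x\<in>D. g x = z}) = N * M"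
      using Z(2) g'(2) by simp
    fix x assume x: "x \<in> {x\<in>D. g x \<in> E}" "f (g x) = y"
    then have "regular_at g x"
      using g[of "g x"] unfolding regular_fibre_def by auto
    moreover have "regular_at f (g x)"
      using x Z(3) unfolding Z_def by auto
    ultimately show "regular_at (\<lambda>x. f (g x)) x"
      by (rule regular_at_compose[rotated])
  qed
qed

text \<open>\<open>P\<close> is the set of masses. The compactness clause encodes the poles: a
  sequence of bounded points approaching \<open>P\<close> must have unbounded images, since the
  compact set avoids \<open>P\<close>.\<close>

definition lens_like :: "'a::euclidean_space set \<Rightarrow> ('a \<Rightarrow> 'a) \<Rightarrow> bool" where
  "lens_like P f \<longleftrightarrow> closed P \<and> C1_on (-P) f \<and>
    (\<exists>R. \<forall>x. R \<le> norm x \<longrightarrow> norm (f x - x) \<le> 1) \<and>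
    (\<forall>M. compact {x\<in>-P. norm x \<le> M \<and> norm (f x) \<le> M})"

text \<open>\<open>a\<close> and \<open>b\<close> stand for the points on the last two planes as
  functions of the first point of the ray. The last clause says that \<open>b\<close> is proper on
  \<open>D\<close>; the growth clause will keep a weak coupling to \<open>a\<close> dominated by
  \<open>b\<close>.\<close>

definition controlled ::
  "'a::euclidean_space set \<Rightarrow> ('a \<Rightarrow> 'a) \<Rightarrow> ('a \<Rightarrow> 'a) \<Rightarrow> bool" where
  "controlled D a b \<longleftrightarrow> open D \<and> C1_on D a \<and> C1_on D b \<and>
    (\<exists>R. \<forall>x\<in>D. norm (a x) \<le> 2 * norm (b x) + R) \<and>
    (\<forall>M. compact {x\<in>D. norm (b x) \<le> M})"

lemma controlled_compact_vimage:
  assumes "controlled D a b" "compact S"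
  shows "compact {x\<in>D. b x \<in> S}"
proof -
  obtain M where M: "\<And>x. x \<in> S \<Longrightarrow> norm x \<le> M"
    using compact_imp_bounded[OF assms(2)] unfolding bounded_iff by blast
  define T where "T = {x\<in>D. norm (b x) \<le> M}"
  have T: "compact T" "T \<subseteq> D" and b: "continuous_on D b"
    using assms(1) C1_on_imp_continuous_on unfolding controlled_def T_def by auto
  have "closed (T \<inter> b -` S)"
    using continuous_on_subset[OF b T(2)] compact_imp_closed[OF T(1)] compact_imp_closed[OF assms(2)]
    by (rule continuous_closed_preimage)
  then have "compact (T \<inter> (T \<inter> b -` S))"
    using T(1) by (intro compact_Int_closed)
  moreover have "T \<inter> (T \<inter> b -` S) = {x\<in>D. b x \<in> S}"
    using M by (auto simp: T_def)
  ultimately show ?thesis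
    by simp
qed

text \<open>A ray that leaves the previous planes far from the axis cannot be bent back:
  the deflection is bounded there, and the coupling to the plane before is weak.\<close>

lemma controlled_step_bounds:
  fixes a b f :: "'a::euclidean_space \<Rightarrow> 'a"
  assumes ab: "controlled D a b" and f: "lens_like P f"
  obtains R where "\<And>e x. \<bar>e\<bar> \<le> 1 / 8 \<Longrightarrow> x \<in> D \<Longrightarrow>
      norm (b x) \<le> 2 * norm (f (b x) + e *\<^sub>R (b x - a x)) + R"
    "\<And>e x M. \<bar>e\<bar> \<le> 1 / 8 \<Longrightarrow> x \<in> D \<Longrightarrow> norm (f (b x) + e *\<^sub>R (b x - a x)) \<le> M \<Longrightarrow>
      norm (f (b x)) \<le> 7 * M + R"
proof -
  obtain R1 where R1: "\<And>x. x \<in> D \<Longrightarrow> norm (a x) \<le> 2 * norm (b x) + R1"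
    using ab unfolding controlled_def by blast
  obtain R2 where R2: "\<And>x. R2 \<le> norm x \<Longrightarrow> norm (f x - x) \<le> 1"
    using f unfolding lens_like_def by blast
  \<comment> \<open>As \<open>a\<close> is at most twice \<open>b\<close> up to a constant, the
    difference is at most 3 times \<open>b\<close>, and the coupling at most 3/8 of it. The
    remaining 5/8 of \<open>b\<close> is bounded by the new point, and 8/5 \<le> 2 restores the
    factor 2 of \<open>controlled\<close>.\<close>
  have small: "norm (e *\<^sub>R (b x - a x)) \<le> 3 / 8 * norm (b x) + \<bar>R1\<bar> / 8"
    if "\<bar>e\<bar> \<le> 1 / 8" "x \<in> D" for e x
  proof -
    have "norm (b x - a x) \<le> 3 * norm (b x) + \<bar>R1\<bar>"
      using norm_triangle_ineq4[of "b x" "a x"] R1[OF that(2)] by linarith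
    then have "\<bar>e\<bar> * norm (b x - a x) \<le> 1 / 8 * (3 * norm (b x) + \<bar>R1\<bar>)"
      using that by (intro mult_mono) auto
    then show ?thesis
      using that by simp
  qed
  define R where "R = 2 + \<bar>R1\<bar> + \<bar>R2\<bar>"
  have 1: "norm (b x) \<le> 2 * norm (f (b x) + e *\<^sub>R (b x - a x)) + R"
    if "\<bar>e\<bar> \<le> 1 / 8" "x \<in> D" for e x
  proof (cases "R2 \<le> norm (b x)")
    case True
    have "b x = (f (b x) + e *\<^sub>R (b x - a x)) - (f (b x) - b x) - e *\<^sub>R (b x - a x)"
      by simp
    then have "norm (b x) \<le> norm (f (b x) + e *\<^sub>R (b x - a x)) + norm (f (b x) - b x)
        + norm (e *\<^sub>R (b x - a x))"
      by (smt (verit, ccfv_threshold) norm_triangle_ineq4)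
    then show ?thesis
      using R2[OF True] small[OF that] norm_ge_zero[of "f (b x) + e *\<^sub>R (b x - a x)"]
      unfolding R_def by linarith
  next
    case False
    then show ?thesis
      using norm_ge_zero[of "f (b x) + e *\<^sub>R (b x - a x)"] unfolding R_def by linarith
  qed
  show thesis
  proof (rule that[of "3 * R"])
    have R: "\<bar>R1\<bar> \<le> R" "R \<ge> 0"
      unfolding R_def by auto
    fix e :: real and x
    assume e: "\<bar>e\<bar> \<le> 1 / 8" "x \<in> D"
    show "norm (b x) \<le> 2 * norm (f (b x) + e *\<^sub>R (b x - a x)) + 3 * R"
      using 1[OF e] R by linarith
    fix M assume M: "norm (f (b x) + e *\<^sub>R (b x - a x)) \<le> M"
    have "norm (f (b x)) \<le> norm (f (b x) + e *\<^sub>R (b x - a x)) + norm (e *\<^sub>R (b x - a x))"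
      using norm_triangle_ineq4[of "f (b x) + e *\<^sub>R (b x - a x)" "e *\<^sub>R (b x - a x)"] by simp
    then show "norm (f (b x)) \<le> 7 * M + 3 * R"
      using 1[OF e] small[OF e] M R norm_ge_zero[of "f (b x) + e *\<^sub>R (b x - a x)"] by linarith
  qed
qed

text \<open>A bounded new point bounds both \<open>b x\<close> and \<open>f (b x)\<close>. Then
  \<open>b x\<close> stays in a compact set away from the masses, and properness of \<open>b\<close>
  pulls this back to a compact set of first points.\<close>

lemma controlled_step:
  assumes ab: "controlled D a b" and f: "lens_like P f" and e: "\<bar>e\<bar> \<le> 1 / 8"
  shows "controlled {x\<in>D. b x \<notin> P} b (\<lambda>x. f (b x) + e *\<^sub>R (b x - a x))"
proof -
  obtain R where R: "\<And>x. x \<in> D \<Longrightarrow> norm (b x) \<le> 2 * norm (f (b x) + e *\<^sub>R (b x - a x)) + R"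
    "\<And>x M. x \<in> D \<Longrightarrow> norm (f (b x) + e *\<^sub>R (b x - a x)) \<le> M \<Longrightarrow> norm (f (b x)) \<le> 7 * M + R"
    using controlled_step_bounds[OF ab f] e by metis
  have D: "open D" and a: "C1_on D a" and b: "C1_on D b"
    using ab unfolding controlled_def by auto
  have P: "closed P" and C1f: "C1_on (-P) f"
    using f unfolding lens_like_def by auto
  let ?D = "{x\<in>D. b x \<notin> P}" and ?b = "\<lambda>x. f (b x) + e *\<^sub>R (b x - a x)"
  have "open (D \<inter> b -` (-P))"
    using continuous_on_open_vimage[OF D] C1_on_imp_continuous_on[OF b] P
    by (metis Int_commute open_Compl)
  moreover have "D \<inter> b -` (-P) = ?D"
    by auto
  ultimately have open_D: "open ?D"
    by simp
  have b': "C1_on ?D b" and a': "C1_on ?D a"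
    using C1_on_subset[OF b] C1_on_subset[OF a] by auto
  have C1: "C1_on ?D ?b"
    by (intro C1_on_add C1_on_scaleR C1_on_diff C1_on_const a' b' C1_on_compose[OF C1f]) auto
  have "compact {x\<in>?D. norm (?b x) \<le> M}" for M
  proof -
    define M' where "M' = 7 * \<bar>M\<bar> + \<bar>R\<bar>"
    have "compact {x\<in>-P. norm x \<le> M' \<and> norm (f x) \<le> M'}"
      using f unfolding lens_like_def by blast
    then have comp: "compact {x\<in>D. b x \<in> {x\<in>-P. norm x \<le> M' \<and> norm (f x) \<le> M'}}" (is "compact ?C")
      by (rule controlled_compact_vimage[OF ab])
    \<comment> \<open>Because \<open>?C\<close> lies inside the new domain, the new map is
      continuous on it and its sublevel set is closed.\<close>
    have sub: "?C \<subseteq> ?D"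
      by auto
    have "continuous_on ?C (\<lambda>x. norm (?b x))"
      by (intro continuous_intros continuous_on_subset[OF C1_on_imp_continuous_on[OF C1] sub])
    then have "closed (?C \<inter> (\<lambda>x. norm (?b x)) -` {..M})"
      using compact_imp_closed[OF comp] by (rule continuous_closed_preimage) simp
    then have "compact (?C \<inter> (?C \<inter> (\<lambda>x. norm (?b x)) -` {..M}))"
      using comp by (intro compact_Int_closed)
    moreover have "?C \<inter> (?C \<inter> (\<lambda>x. norm (?b x)) -` {..M}) = {x\<in>?D. norm (?b x) \<le> M}"
    proof -
      have "norm (b x) \<le> M' \<and> norm (f (b x)) \<le> M'" if "x \<in> D" "norm (?b x) \<le> M" for x
        using R(1)[OF that(1)] R(2)[OF that] that(2) norm_ge_zero[of "?b x"] unfolding M'_def by linarith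
      then show ?thesis
        by auto
    qed
    ultimately show ?thesis
      by simp
  qed
  then show ?thesis
    unfolding controlled_def using open_D C1 b' R(1) by blast
qed

text \<open>Coupling and source form one parameter (e, y), perturbed from (0, 0). A neighbourhood of
  (0, 0) contains a fixed positive e together with a whole disc of y.\<close>

lemma regular_fibre_step:
  fixes a b f :: "'a::euclidean_space \<Rightarrow> 'a"
  assumes ab: "controlled D a b" and f: "lens_like P f"
    and fib_b: "\<And>y. norm y < \<delta> \<Longrightarrow> regular_fibre D b y N"
    and fib_f: "regular_fibre (-P) f 0 M" and zeros: "\<And>z. z \<notin> P \<Longrightarrow> f z = 0 \<Longrightarrow> norm z < \<delta>"
  obtains e \<delta>' where "0 < e" "e \<le> 1 / 8" "\<delta>' > 0"
    "\<And>y. norm y < \<delta>' \<Longrightarrow>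
      regular_fibre {x\<in>D. b x \<notin> P} (\<lambda>x. f (b x) + e *\<^sub>R (b x - a x)) y (M * N)"
proof -
  let ?D = "{x\<in>D. b x \<notin> P}"
  have D: "open ?D"
    using controlled_step[OF ab f, of 0] unfolding controlled_def by simp
  define G :: "(real \<times> 'a) \<times> 'a \<Rightarrow> 'a"
    where "G = (\<lambda>z. (f (b (snd z)) + fst (fst z) *\<^sub>R (b (snd z) - a (snd z))) - snd (fst z))"
  have lin: "C1_on (UNIV \<times> ?D) (\<lambda>z. snd z)" "C1_on (UNIV \<times> ?D) (\<lambda>z. fst (fst z))"
    "C1_on (UNIV \<times> ?D) (\<lambda>z. snd (fst z))"
    by (intro C1_on_bounded_linear bounded_linear_intros)+
  have a: "C1_on D a" and b: "C1_on D b" and C1f: "C1_on (-P) f"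
    using ab f unfolding controlled_def lens_like_def by auto
  have b': "C1_on (UNIV \<times> ?D) (\<lambda>z. b (snd z))" and a': "C1_on (UNIV \<times> ?D) (\<lambda>z. a (snd z))"
    by (rule C1_on_compose[OF b lin(1)] C1_on_compose[OF a lin(1)]; auto)+
  have "C1_on (UNIV \<times> ?D) (\<lambda>z. f (b (snd z)))"
    by (rule C1_on_compose[OF C1f b']) auto
  then have C1: "C1_on (UNIV \<times> ?D) G"
    unfolding G_def by (intro C1_on_diff C1_on_add C1_on_scaleR lin a' b')
  obtain R where R: "\<And>e x. \<bar>e\<bar> \<le> 1 / 8 \<Longrightarrow> x \<in> D \<Longrightarrow>
      norm (b x) \<le> 2 * norm (f (b x) + e *\<^sub>R (b x - a x)) + R"
    "\<And>e x M. \<bar>e\<bar> \<le> 1 / 8 \<Longrightarrow> x \<in> D \<Longrightarrow> norm (f (b x) + e *\<^sub>R (b x - a x)) \<le> M \<Longrightarrow>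
      norm (f (b x)) \<le> 7 * M + R"
    using controlled_step_bounds[OF ab f] by metis
  \<comment> \<open>Parameters within 1/8 of the origin have
    \<open>\<bar>e\<bar> \<le> 1 / 8\<close> and \<open>norm y \<le> 1\<close>, so both bounds apply
    with M = 1.\<close>
  define M' where "M' = 7 + \<bar>R\<bar>"
  let ?C = "{x\<in>D. b x \<in> {x\<in>-P. norm x \<le> M' \<and> norm (f x) \<le> M'}}"
  have "compact {x\<in>-P. norm x \<le> M' \<and> norm (f x) \<le> M'}"
    using f unfolding lens_like_def by blast
  then have comp: "compact ?C"
    by (rule controlled_compact_vimage[OF ab])
  have bound: "x \<in> ?C" if "dist (0, 0) p \<le> 1 / 8" "x \<in> ?D" "G (p, x) = 0" for p x
  proof -
    have p: "\<bar>fst p\<bar> \<le> 1 / 8" "norm (snd p) \<le> 1"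
      using that(1) norm_fst_le[of "fst p" "snd p"] norm_snd_le[of "snd p" "fst p"]
      by (auto simp: dist_norm zero_prod_def[symmetric])
    have x: "x \<in> D" "f (b x) + fst p *\<^sub>R (b x - a x) = snd p"
      using that(2,3) by (auto simp: G_def)
    have "norm (b x) \<le> M'" "norm (f (b x)) \<le> M'"
      using R(1)[OF p(1) x(1)] R(2)[OF p(1) x(1), of 1] p(2) unfolding M'_def x(2) by linarith+
    then show ?thesis
      using that(2) by simp
  qed
  \<comment> \<open>At e = 0 the planes decouple: each of the \<open>M\<close> zeros of
    \<open>f\<close> lies in the disc over which \<open>b\<close> has \<open>N\<close> regular
    preimages.\<close>
  have "regular_fibre {x\<in>D. b x \<in> -P} (\<lambda>x. f (b x)) 0 (M * N)"
    using fib_f by (rule regular_fibre_compose) (use fib_b zeros in auto)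
  then have fib: "regular_fibre ?D (\<lambda>x. G ((0, 0), x)) 0 (M * N)"
    by (simp add: G_def)
  have "\<forall>\<^sub>F p in nhds (0, 0). regular_fibre ?D (\<lambda>x. G (p, x)) 0 (M * N)"
    by (rule regular_fibre_perturb[OF D C1 comp _ _ bound fib, of "1 / 8"]) auto
  then obtain s where s: "s > 0"
    "\<And>p. dist p (0, 0) < s \<Longrightarrow> regular_fibre ?D (\<lambda>x. G (p, x)) 0 (M * N)"
    unfolding eventually_nhds_metric by blast
  show thesis
  proof (rule that)
    show "0 < min (s / 2) (1 / 8)" "min (s / 2) (1 / 8) \<le> 1 / 8" "s / 2 > 0"
      using s(1) by auto
    fix y :: 'a assume y: "norm y < s / 2"
    have "norm (min (s / 2) (1 / 8), y) < s"
      using norm_Pair_le[of "min (s / 2) (1 / 8)" y] y s(1) by auto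
    then have "regular_fibre ?D (\<lambda>x. G ((min (s / 2) (1 / 8), y), x)) 0 (M * N)"
      by (intro s(2)) (simp add: dist_norm zero_prod_def[symmetric])
    then show "regular_fibre ?D (\<lambda>x. f (b x) + min (s / 2) (1 / 8) *\<^sub>R (b x - a x)) y (M * N)"
      by (simp add: G_def regular_fibre_diff_const)
  qed
qed

section \<open>Point-mass lenses\<close>

text \<open>The weight \<open>c l\<close> stands for \<beta> times the squared Einstein radius. The
  space is general because the lens is built in \<open>complex\<close> and used in
  \<open>real ^ 2\<close>.\<close>

definition point_lens :: "nat \<Rightarrow> (nat \<Rightarrow> real) \<Rightarrow> (nat \<Rightarrow> 'a) \<Rightarrow> 'a \<Rightarrow> 'a::euclidean_space" where
  "point_lens m c \<xi> x = x - (\<Sum>l = 1..m. c l *\<^sub>R ((x - \<xi> l) /\<^sub>R (norm (x - \<xi> l))\<^sup>2))"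

lemma norm_inversion: "norm (x /\<^sub>R (norm x)\<^sup>2) = inverse (norm (x :: 'a::real_normed_vector))"
  by (simp add: power2_eq_square divide_simps)

lemma C1_on_inversion: "C1_on (- {0}) (\<lambda>x :: 'a::euclidean_space. x /\<^sub>R (norm x)\<^sup>2)"
proof (rule C1_onI)
  fix x :: 'a assume "x \<in> - {0}"
  then have "inner x x \<noteq> 0"
    by simp
  then show "((\<lambda>x. x /\<^sub>R (norm x)\<^sup>2) has_derivative
      (\<lambda>v. inverse (inner x x) *\<^sub>R v - (inverse (inner x x) * (inner x v + inner v x) * inverse (inner x x)) *\<^sub>R x)) (at x)"
    unfolding power2_norm_eq_inner by (auto intro!: derivative_eq_intros)
next
  show "continuous_on (- {0}) (\<lambda>x. inverse (inner x x) *\<^sub>R v -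
      (inverse (inner x x) * (inner x v + inner v x) * inverse (inner x x)) *\<^sub>R x)" for v :: 'a
    by (auto intro!: continuous_intros)
qed

lemma C1_on_point_lens:
  fixes \<xi> :: "nat \<Rightarrow> 'a::euclidean_space"
  shows "C1_on (- \<xi> ` {1..m}) (point_lens m c \<xi>)"
proof -
  have shift: "C1_on (- \<xi> ` {1..m}) (\<lambda>x. x - \<xi> l)" for l
    by (intro C1_on_diff C1_on_const C1_on_bounded_linear bounded_linear_ident)
  have "C1_on (- \<xi> ` {1..m}) (\<lambda>x. (x - \<xi> l) /\<^sub>R (norm (x - \<xi> l))\<^sup>2)" if "l \<in> {1..m}" for l
    by (rule C1_on_compose[OF C1_on_inversion shift]) (use that in auto)
  then show ?thesis
    unfolding point_lens_def[abs_def]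
    by (intro C1_on_diff[OF C1_on_bounded_linear[OF bounded_linear_ident]] C1_on_sum
        C1_on_scaleR[OF C1_on_const])
qed

lemma point_lens_near_identity:
  "\<exists>R. \<forall>x. R \<le> norm x \<longrightarrow> norm (point_lens m c \<xi> x - x) \<le> 1"
proof -
  have term0: "((\<lambda>x. c l *\<^sub>R ((x - \<xi> l) /\<^sub>R (norm (x - \<xi> l))\<^sup>2)) \<longlongrightarrow> c l *\<^sub>R 0) at_infinity" for l
  proof (rule tendsto_scaleR[OF tendsto_const], rule tendsto_norm_zero_cancel)
    have "filterlim (\<lambda>x. x + - \<xi> l) at_infinity at_infinity"
      by (rule tendsto_add_filterlim_at_infinity'[OF filterlim_ident tendsto_const])
    then have "filterlim (\<lambda>x. norm (x - \<xi> l)) at_top at_infinity"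
      using filterlim_at_infinity_imp_norm_at_top by fastforce
    then show "((\<lambda>x. norm ((x - \<xi> l) /\<^sub>R (norm (x - \<xi> l))\<^sup>2)) \<longlongrightarrow> 0) at_infinity"
      unfolding norm_inversion by (rule tendsto_inverse_0_at_top)
  qed
  have "((\<lambda>x. \<Sum>l = 1..m. c l *\<^sub>R ((x - \<xi> l) /\<^sub>R (norm (x - \<xi> l))\<^sup>2)) \<longlongrightarrow> (\<Sum>l = 1..m. c l *\<^sub>R 0))
      at_infinity"
    by (intro tendsto_sum term0)
  from this[unfolded Lim_at_infinity, rule_format, of 1] obtain R where
    "\<And>x. R \<le> norm x \<Longrightarrow> norm (\<Sum>l = 1..m. c l *\<^sub>R ((x - \<xi> l) /\<^sub>R (norm (x - \<xi> l))\<^sup>2)) < 1"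
    by auto
  then show ?thesis
    by (intro exI[of _ R]) (auto simp: point_lens_def less_imp_le)
qed

text \<open>The \<open>k\<close>-th term alone blows up at its mass; distinct positions keep the
  other terms convergent there.\<close>

lemma point_lens_pole:
  fixes \<xi> :: "nat \<Rightarrow> 'a::euclidean_space"
  assumes inj: "inj_on \<xi> {1..m}" and k: "k \<in> {1..m}" "c k > 0"
  shows "filterlim (point_lens m c \<xi>) at_infinity (at (\<xi> k))"
proof -
  let ?t = "\<lambda>l x. c l *\<^sub>R ((x - \<xi> l) /\<^sub>R (norm (x - \<xi> l))\<^sup>2)"
  have "((\<lambda>x. x - (\<Sum>l\<in>{1..m} - {k}. ?t l x)) \<longlongrightarrow> \<xi> k - (\<Sum>l\<in>{1..m} - {k}. ?t l (\<xi> k))) (at (\<xi> k))"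
    using inj k by (intro tendsto_intros) (auto dest: inj_onD)
  moreover have "filterlim (\<lambda>x. - ?t k x) at_infinity (at (\<xi> k))"
  proof (rule filterlim_norm_at_top_imp_at_infinity)
    have "((\<lambda>x. inverse (c k) * norm (x - \<xi> k)) \<longlongrightarrow> inverse (c k) * norm (\<xi> k - \<xi> k)) (at (\<xi> k))"
      by (intro tendsto_intros)
    then have "filterlim (\<lambda>x. inverse (inverse (c k) * norm (x - \<xi> k))) at_top (at (\<xi> k))"
      using k(2) by (intro filterlim_inverse_at_top)
        (auto simp: eventually_at_filter intro!: always_eventually)
    moreover have "norm (- ?t k x) = inverse (inverse (c k) * norm (x - \<xi> k))" for x
      using k(2) norm_inversion[of "x - \<xi> k"] by (simp only: norm_minus_cancel norm_scaleR) simp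
    ultimately show "filterlim (\<lambda>x. norm (- ?t k x)) at_top (at (\<xi> k))"
      by (simp only:)
  qed
  ultimately have "filterlim (\<lambda>x. (x - (\<Sum>l\<in>{1..m} - {k}. ?t l x)) + - ?t k x) at_infinity (at (\<xi> k))"
    by (rule tendsto_add_filterlim_at_infinity)
  moreover have "(x - (\<Sum>l\<in>{1..m} - {k}. ?t l x)) + - ?t k x = point_lens m c \<xi> x" for x
    using k(1) by (simp only: point_lens_def sum.remove[OF finite_atLeastAtMost k(1)]) simp
  ultimately show ?thesis
    by (simp only:)
qed

lemma lens_like_point_lens:
  fixes \<xi> :: "nat \<Rightarrow> 'a::euclidean_space"
  assumes "inj_on \<xi> {1..m}" "\<And>l. l \<in> {1..m} \<Longrightarrow> c l > 0"
  shows "lens_like (\<xi> ` {1..m}) (point_lens m c \<xi>)"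
proof -
  let ?P = "\<xi> ` {1..m}" and ?f = "point_lens m c \<xi>"
  have closed_P: "closed ?P"
    by (simp add: finite_imp_closed)
  have "compact {x\<in>-?P. norm x \<le> M \<and> norm (?f x) \<le> M}" (is "compact ?S") for M
  proof -
    have "closed ?S"
      unfolding closed_sequential_limits
    proof (intro allI impI, elim conjE)
      fix x l assume x: "\<forall>n. x n \<in> ?S" and lim: "x \<longlonglongrightarrow> l"
      \<comment> \<open>A sequence converging to a mass would have unbounded images, against the
        bound \<open>M\<close>.\<close>
      have "l \<notin> ?P"
      proof
        assume "l \<in> ?P"
        then obtain k where k: "k \<in> {1..m}" "l = \<xi> k"
          by blast
        have "filterlim x (at l) sequentially"
          using lim x \<open>l \<in> ?P\<close> unfolding filterlim_at by (auto intro!: always_eventually)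
        then have "filterlim (\<lambda>n. ?f (x n)) at_infinity sequentially"
          using filterlim_compose[OF point_lens_pole] assms k by metis
        then have "\<forall>\<^sub>F n in sequentially. \<bar>M\<bar> + 1 \<le> norm (?f (x n))"
          by (auto simp: filterlim_at_infinity[OF order_refl])
        then obtain n where "\<bar>M\<bar> + 1 \<le> norm (?f (x n))"
          by (auto simp: eventually_sequentially)
        then show False
          using x[rule_format, of n] by auto
      qed
      have "isCont ?f l"
        using C1_on_imp_continuous_on[OF C1_on_point_lens, of \<xi> m c] \<open>l \<notin> ?P\<close>
        unfolding continuous_on_eq_continuous_at[OF open_Compl[OF closed_P]] by blast
      then have lim': "(\<lambda>n. ?f (x n)) \<longlonglongrightarrow> ?f l"
        using lim by (rule isCont_tendsto_compose)
      have "norm l \<le> M"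
        by (rule Lim_norm_ubound[OF sequentially_bot lim]) (use x in \<open>simp add: always_eventually\<close>)
      moreover have "norm (?f l) \<le> M"
        by (rule Lim_norm_ubound[OF sequentially_bot lim']) (use x in \<open>simp add: always_eventually\<close>)
      ultimately show "l \<in> ?S"
        using \<open>l \<notin> ?P\<close> by simp
    qed
    moreover have "bounded ?S"
      by (auto simp: bounded_iff)
    ultimately show ?thesis
      by (simp add: compact_eq_bounded_closed)
  qed
  then show ?thesis
    unfolding lens_like_def using closed_P C1_on_point_lens point_lens_near_identity by blast
qed

section \<open>Rescaling lenses and moving them between spaces\<close>

lemma regular_at_bounded_linear:
  assumes "bounded_linear T" "inj T"
  shows "regular_at T x"
  using assms bounded_linear_imp_has_derivative unfolding regular_at_def by blast

text \<open>Used twice: with a homothety to shrink a lens, and with the identification of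
  \<open>complex\<close> and \<open>real ^ 2\<close>.\<close>

lemma regular_fibre_conjugate:
  fixes f :: "'a::euclidean_space \<Rightarrow> 'a" and T :: "'a \<Rightarrow> 'b::euclidean_space"
  assumes T: "bounded_linear T" and S: "bounded_linear S"
    and inv: "\<And>x. S (T x) = x" "\<And>y. T (S y) = y"
    and f: "regular_fibre D f y N"
  shows "regular_fibre (T ` D) (\<lambda>x. T (f (S x))) (T y) N"
proof -
  have inj: "inj T" "inj S"
    by (metis inv(1) injI) (metis inv(2) injI)
  have eq: "{x \<in> T ` D. T (f (S x)) = T y} = T ` {x\<in>D. f x = y}"
    using inv by (auto simp: inj_eq[OF inj(1)])
  show ?thesis
    unfolding regular_fibre_def eq
  proof (intro conjI ballI impI)
    show "finite (T ` {x\<in>D. f x = y})" "card (T ` {x\<in>D. f x = y}) = N"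
      using f card_image[OF inj_on_subset[OF inj(1) subset_UNIV]] unfolding regular_fibre_def by auto
    fix x assume "x \<in> T ` D" "T (f (S x)) = T y"
    then have "regular_at f (S x)"
      using f inv(1) unfolding regular_fibre_def by (auto simp: inj_eq[OF inj(1)])
    then have "regular_at (\<lambda>x. f (S x)) x"
      by (rule regular_at_compose[OF _ regular_at_bounded_linear[OF S inj(2)]])
    then show "regular_at (\<lambda>x. T (f (S x))) x"
      by (rule regular_at_compose[OF regular_at_bounded_linear[OF T inj(1)]])
  qed
qed

text \<open>The deflection of a point mass is homogeneous of degree -1, so a similarity of ratio s
  divides it by s; weights multiplied by \<open>s\<^sup>2\<close> turn this into the factor s that
  the image under \<open>T\<close> requires.\<close>

lemma point_lens_conjugate:
  fixes \<xi> :: "nat \<Rightarrow> 'a::euclidean_space" and T :: "'a \<Rightarrow> 'b::euclidean_space"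
  assumes T: "linear T" and inv: "T (S x) = x" and norm_T: "\<And>x. norm (T x) = s * norm x" and s: "s > 0"
  shows "point_lens m (\<lambda>l. s\<^sup>2 * c l) (\<lambda>l. T (\<xi> l)) x = T (point_lens m c \<xi> (S x))"
proof -
  have "x - T (\<xi> l) = T (S x - \<xi> l)" for l
    using inv by (simp add: linear_diff[OF T])
  then have "(s\<^sup>2 * c l) *\<^sub>R ((x - T (\<xi> l)) /\<^sub>R (norm (x - T (\<xi> l)))\<^sup>2) =
      T (c l *\<^sub>R ((S x - \<xi> l) /\<^sub>R (norm (S x - \<xi> l))\<^sup>2))" for l
    using s by (simp add: norm_T power_mult_distrib linear_scale[OF T])
  then have "(\<Sum>l = 1..m. (s\<^sup>2 * c l) *\<^sub>R ((x - T (\<xi> l)) /\<^sub>R (norm (x - T (\<xi> l)))\<^sup>2)) =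
      T (\<Sum>l = 1..m. c l *\<^sub>R ((S x - \<xi> l) /\<^sub>R (norm (S x - \<xi> l))\<^sup>2))"
    by (simp only: linear_sum[OF T])
  then show ?thesis
    using inv by (simp only: point_lens_def linear_diff[OF T])
qed

lemma point_lens_small_zeros:
  fixes \<xi> :: "nat \<Rightarrow> 'a::euclidean_space"
  assumes inj: "inj_on \<xi> {1..m}" and c: "\<And>l. l \<in> {1..m} \<Longrightarrow> c l > 0"
    and fib: "regular_fibre (- \<xi> ` {1..m}) (point_lens m c \<xi>) 0 N" and \<delta>: "\<delta> > 0"
  obtains c' and \<xi>' :: "nat \<Rightarrow> 'a" where "inj_on \<xi>' {1..m}" "\<And>l. l \<in> {1..m} \<Longrightarrow> c' l > 0"
    "regular_fibre (- \<xi>' ` {1..m}) (point_lens m c' \<xi>') 0 N"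
    "\<And>z. z \<notin> \<xi>' ` {1..m} \<Longrightarrow> point_lens m c' \<xi>' z = 0 \<Longrightarrow> norm z < \<delta>"
proof -
  define Z where "Z = {z\<in>- \<xi> ` {1..m}. point_lens m c \<xi> z = 0}"
  have "finite Z"
    using fib unfolding Z_def regular_fibre_def by blast
  then obtain B where B: "B > 0" "\<And>z. z \<in> Z \<Longrightarrow> norm z \<le> B"
    using finite_imp_bounded bounded_pos by metis
  \<comment> \<open>Zeros of norm at most \<open>B\<close> are moved to norm at most
    \<open>s * B\<close>, which is \<delta> / 2.\<close>
  define s where "s = \<delta> / (2 * B)"
  have s: "s > 0"
    using B \<delta> by (simp add: s_def)
  define T S where "T = (\<lambda>x :: 'a. s *\<^sub>R x)" and "S = (\<lambda>x :: 'a. x /\<^sub>R s)"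
  have T: "bounded_linear T" and S: "bounded_linear S"
    and inv: "\<And>x. S (T x) = x" "\<And>y. T (S y) = y" and nT: "\<And>x. norm (T x) = s * norm x"
    using s unfolding T_def S_def by (auto intro: bounded_linear_scaleR_right)
  have eq: "point_lens m (\<lambda>l. s\<^sup>2 * c l) (\<lambda>l. T (\<xi> l)) = (\<lambda>x. T (point_lens m c \<xi> (S x)))"
    by (rule ext) (rule point_lens_conjugate[OF bounded_linear.linear[OF T] inv(2) nT s])
  have inj_T: "inj T"
    by (metis inv(1) injI)
  have "surj T"
    using inv(2) by (rule surjI)
  then have poles: "- (\<lambda>l. T (\<xi> l)) ` {1..m} = T ` (- \<xi> ` {1..m})"
    using inj_T by (simp add: bij_image_Compl_eq bij_def image_image)
  show thesis
  proof (rule that[where \<xi>' = "\<lambda>l. T (\<xi> l)" and c' = "\<lambda>l. s\<^sup>2 * c l"])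
    show "inj_on (\<lambda>l. T (\<xi> l)) {1..m}"
      using comp_inj_on[OF inj inj_on_subset[OF inj_T subset_UNIV]] by (simp add: comp_def)
    show "s\<^sup>2 * c l > 0" if "l \<in> {1..m}" for l
      using c[OF that] s by simp
    have "T 0 = 0"
      by (simp add: T_def)
    then show "regular_fibre (- (\<lambda>l. T (\<xi> l)) ` {1..m})
        (point_lens m (\<lambda>l. s\<^sup>2 * c l) (\<lambda>l. T (\<xi> l))) 0 N"
      using regular_fibre_conjugate[OF T S inv fib] unfolding eq poles by simp
    fix z assume z: "z \<notin> (\<lambda>l. T (\<xi> l)) ` {1..m}"
      "point_lens m (\<lambda>l. s\<^sup>2 * c l) (\<lambda>l. T (\<xi> l)) z = 0"
    have "S z \<notin> \<xi> ` {1..m}"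
    proof
      assume "S z \<in> \<xi> ` {1..m}"
      then obtain l where "l \<in> {1..m}" "T (S z) = T (\<xi> l)"
        by (metis imageE)
      then show False
        using z(1) inv(2)[of z] by auto
    qed
    moreover have "s *\<^sub>R point_lens m c \<xi> (S z) = 0"
      using z(2) fun_cong[OF eq, of z] by (simp only: T_def)
    ultimately have "norm (S z) \<le> B"
      using B(2) s by (simp add: Z_def)
    then have "s * norm (S z) \<le> s * B"
      using s by (intro mult_left_mono) simp_all
    then have "norm z \<le> s * B"
      using nT[of "S z"] by (simp only: inv(2))
    also have "s * B < \<delta>"
      using B(1) \<delta> by (simp add: s_def)
    finally show "norm z < \<delta>" .
  qed
qed

section \<open>Lenses with rotational symmetry\<close>

lemma sum_powers_roots_unity:
  assumes "j < n"
  shows "(\<Sum>w | w ^ n = 1. (w :: complex) ^ j) = (if j = 0 then of_nat n else 0)"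
proof -
  have n: "n > 0"
    using assms by simp
  define q where "q = cis (2 * pi * real j / real n)"
  note bij = Complex.bij_betw_roots_unity[OF n]
  have "(\<Sum>w | w ^ n = 1. (w :: complex) ^ j) = (\<Sum>k<n. cis (2 * pi * real k / real n) ^ j)"
    using sum.reindex_bij_betw[OF bij, of "\<lambda>w. w ^ j"] by simp
  also have "\<dots> = (\<Sum>k<n. q ^ k)"
    unfolding q_def Complex.DeMoivre
    by (intro sum.cong arg_cong[of _ _ cis] refl) (simp add: mult_ac)
  also have "\<dots> = (if j = 0 then of_nat n else 0)"
  proof (cases "j = 0")
    case False
    have "q \<noteq> 1"
      using inj_onD[OF bij_betw_imp_inj_on[OF bij], of j 0] assms n False by (auto simp: q_def)
    moreover have "q ^ n = 1"
      using bij_betwE[OF bij] assms unfolding q_def by auto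
    ultimately show ?thesis
      using False by (simp add: geometric_sum)
  qed (simp add: q_def)
  finally show ?thesis .
qed

text \<open>This is the logarithmic derivative of z^n - 1. As w^n = 1, each 1 / (z - w) is a
  polynomial in w over z^n - 1, and summing over all roots of unity leaves only its constant
  term.\<close>

lemma sum_inverse_roots_unity:
  fixes z :: complex
  assumes n: "n > 0" and z: "z ^ n \<noteq> 1"
  shows "(\<Sum>w | w ^ n = 1. inverse (z - w)) = of_nat n * z ^ (n - 1) / (z ^ n - 1)"
proof -
  have "inverse (z - w) = (\<Sum>j<n. z ^ (n - Suc j) * w ^ j) / (z ^ n - 1)" if "w ^ n = 1" for w
  proof -
    have "z - w \<noteq> 0"
      using that z by auto
    moreover have "z ^ n - 1 = (z - w) * (\<Sum>j<n. z ^ (n - Suc j) * w ^ j)"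
      using power_diff_sumr2[of w n z] that by (metis minus_diff_eq mult_minus_left)
    ultimately show ?thesis
      using z by (simp add: field_simps)
  qed
  then have "(\<Sum>w | w ^ n = 1. inverse (z - w)) =
      (\<Sum>w | w ^ n = 1. (\<Sum>j<n. z ^ (n - Suc j) * w ^ j) / (z ^ n - 1))"
    by simp
  also have "\<dots> = (\<Sum>w | w ^ n = 1. \<Sum>j<n. z ^ (n - Suc j) * w ^ j) / (z ^ n - 1)"
    by (simp add: sum_divide_distrib)
  also have "(\<Sum>w | w ^ n = 1. \<Sum>j<n. z ^ (n - Suc j) * w ^ j) =
      (\<Sum>j<n. z ^ (n - Suc j) * (\<Sum>w | w ^ n = 1. w ^ j))"
    by (subst sum.swap) (simp add: sum_distrib_left)
  also have "\<dots> = (\<Sum>j<n. if j = 0 then z ^ (n - Suc j) * of_nat n else 0)"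
    by (intro sum.cong refl) (simp add: sum_powers_roots_unity)
  also have "\<dots> = of_nat n * z ^ (n - 1)"
    using n by (simp add: sum.delta)
  finally show ?thesis .
qed

lemma complex_inversion: "(z :: complex) /\<^sub>R (norm z)\<^sup>2 = inverse (cnj z)"
  by (cases "z = 0") (simp_all add: scaleR_conv_of_real complex_norm_square field_simps del: of_real_power)

lemma point_lens_complex:
  "point_lens m c \<xi> z = z - cnj (\<Sum>l = 1..m. of_real (c l) * inverse (z - \<xi> l))"
  by (simp only: point_lens_def complex_inversion) (simp add: scaleR_conv_of_real)

text \<open>The Jacobian determinant is 1 - |r'|^2: a kernel vector v of the derivative would
  satisfy |v| = |r'| |v|.\<close>

lemma regular_at_diff_cnj:
  assumes "(r has_field_derivative r') (at z)" "norm r' \<noteq> 1"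
  shows "regular_at (\<lambda>z. z - cnj (r z)) z"
proof -
  have "((\<lambda>z. z - cnj (r z)) has_derivative (\<lambda>v. v - cnj (r' * v))) (at z)"
    using assms(1) unfolding has_field_derivative_def
    by (auto intro!: derivative_eq_intros)
  moreover have "inj (\<lambda>v. v - cnj (r' * v))"
  proof (rule injI)
    fix u v assume "u - cnj (r' * u) = v - cnj (r' * v)"
    then have "u - v = cnj (r' * (u - v))"
      by (simp add: algebra_simps)
    then have "norm (u - v) = norm r' * norm (u - v)"
      by (metis complex_mod_cnj norm_mult)
    then show "u = v"
      using assms(2) by simp
  qed
  ultimately show ?thesis
    unfolding regular_at_def by blast
qed

lemma regular_at_transform:
  assumes "regular_at f x" "open U" "x \<in> U" "\<And>y. y \<in> U \<Longrightarrow> f y = g y"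
  shows "regular_at g x"
  using assms has_derivative_transform_within_open unfolding regular_at_def by metis

lemma regular_fibre_insert:
  assumes fib: "regular_fibre (D - {p}) f y N" and p: "p \<in> D" "f p = y" "regular_at f p"
  shows "regular_fibre D f y (N + 1)"
proof -
  have "{x\<in>D. f x = y} = insert p {x\<in>D - {p}. f x = y}"
    using p by auto
  then show ?thesis
    using fib p unfolding regular_fibre_def by auto
qed

text \<open>The lens with deflection \<open>\<epsilon> / z + 2 z\<^bsup>n-1\<^esup> / (z\<^bsup>n\<^esup> - 1)\<close>. At an image the number
  \<open>s = z\<^bsup>n\<^esup>\<close> is real, so the images are the \<open>n\<close>-th roots of \<open>\<plusminus>t\<^bsup>n\<^esup>\<close> where \<open>t = |z|\<close>.\<close>

definition radii :: "nat \<Rightarrow> real \<Rightarrow> real \<Rightarrow> real set" where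
  "radii n \<epsilon> \<sigma> = {t. t > 0 \<and> \<sigma> * t ^ n \<noteq> 1 \<and> t\<^sup>2 = \<epsilon> + 2 * (\<sigma> * t ^ n) / (\<sigma> * t ^ n - 1)}"

lemma norm_of_real_root:
  fixes z :: complex
  assumes "z ^ n = of_real (\<sigma> * t ^ n)" "\<sigma> \<in> {1, -1}" "t > 0" "n > 0"
  shows "norm z = t"
proof -
  have "norm z ^ n = t ^ n"
    using assms(1-3) by (metis (no_types, lifting) abs_1 abs_minus abs_mult abs_of_pos insertE
      mult_1 norm_of_real norm_power singletonD zero_less_power)
  then show ?thesis
    using assms(3,4) by (metis norm_ge_zero order_less_imp_le power_eq_iff_eq_base)
qed

text \<open>Conjugating and multiplying by z gives |z|^2 = \<epsilon> + 2 s / (s - 1) with s = z^n.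
  A Moebius map with real coefficients has a real value only at real s, so s is plus or minus
  |z|^n.\<close>

lemma lens_equation_iff:
  fixes z :: complex
  assumes n: "n > 0" and z: "z \<noteq> 0"
  shows "z ^ n \<noteq> 1 \<and> z - cnj ((of_real \<epsilon> + 2 * z ^ n / (z ^ n - 1)) / z) = 0 \<longleftrightarrow>
    (\<exists>\<sigma>\<in>{1, -1}. \<exists>t\<in>radii n \<epsilon> \<sigma>. z ^ n = of_real (\<sigma> * t ^ n))" (is "?L \<longleftrightarrow> ?R")
proof -
  have iff: "z - cnj ((of_real \<epsilon> + 2 * z ^ n / (z ^ n - 1)) / z) = 0 \<longleftrightarrow>
    of_real ((norm z)\<^sup>2) = of_real \<epsilon> + 2 * z ^ n / (z ^ n - 1)" (is "?A \<longleftrightarrow> ?B")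
  proof -
    have "?A \<longleftrightarrow> cnj z = (of_real \<epsilon> + 2 * z ^ n / (z ^ n - 1)) / z"
      by (metis complex_cnj_cnj eq_iff_diff_eq_0)
    also have "\<dots> \<longleftrightarrow> z * cnj z = of_real \<epsilon> + 2 * z ^ n / (z ^ n - 1)"
      using z by (metis mult.commute nonzero_divide_eq_eq)
    finally show ?thesis
      by (simp only: complex_norm_square)
  qed
  show ?thesis
  proof
    assume L: ?L
    define q where "q = (norm z)\<^sup>2 - \<epsilon>"
    have "of_real q = 2 * z ^ n / (z ^ n - 1)"
      using L iff by (simp add: q_def)
    then have "of_real q * (z ^ n - 1) = 2 * z ^ n"
      using L by simp
    then have eq: "of_real (q - 2) * z ^ n = of_real q"
      by (simp add: algebra_simps)
    \<comment> \<open>For q = 2 the equation would read 0 = 2.\<close>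
    then have "q \<noteq> 2"
      by auto
    then have "of_real (q - 2) \<noteq> (0 :: complex)"
      by (simp only: of_real_eq_0_iff)
    then have "z ^ n = of_real (q / (q - 2))"
      using eq by (metis nonzero_mult_div_cancel_left of_real_divide)
    then obtain s where s: "z ^ n = of_real s"
      by blast
    have "\<bar>s\<bar> = norm z ^ n"
      using s by (metis norm_of_real norm_power)
    then obtain \<sigma> where \<sigma>: "\<sigma> \<in> {1, -1}" "s = \<sigma> * norm z ^ n"
      by (metis abs_if insertCI minus_minus mult_1 mult_minus1)
    have "of_real ((norm z)\<^sup>2) = (of_real (\<epsilon> + 2 * s / (s - 1)) :: complex)"
      using L iff s by simp
    then have "(norm z)\<^sup>2 = \<epsilon> + 2 * s / (s - 1)"
      by (simp only: of_real_eq_iff)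
    moreover have "s \<noteq> 1"
      using L s by auto
    ultimately have "norm z \<in> radii n \<epsilon> \<sigma>"
      using z \<sigma> by (simp add: radii_def)
    then show ?R
      using s \<sigma> by blast
  next
    assume ?R
    then obtain \<sigma> t where \<sigma>: "\<sigma> \<in> {1, -1}" and t: "t \<in> radii n \<epsilon> \<sigma>" and zn: "z ^ n = of_real (\<sigma> * t ^ n)"
      by blast
    have "norm z = t"
      using norm_of_real_root[OF zn \<sigma> _ n] t by (simp add: radii_def)
    then have "(norm z)\<^sup>2 = \<epsilon> + 2 * (\<sigma> * t ^ n) / (\<sigma> * t ^ n - 1)"
      using t by (simp add: radii_def)
    then have "of_real ((norm z)\<^sup>2) = of_real \<epsilon> + 2 * z ^ n / (z ^ n - 1)"
      unfolding zn by simp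
    moreover have "z ^ n \<noteq> 1"
      using t unfolding zn radii_def by (metis (mono_tags, lifting) mem_Collect_eq of_real_eq_1_iff)
    ultimately show ?L
      using iff by blast
  qed
qed

text \<open>Every sign and radius contributes n roots, and different pairs give disjoint sets of
  roots. With s = \<sigma> t^n, \<open>transversal\<close> says that t is a simple zero of t^2 -
  \<epsilon> - 2 s / (s - 1), whose derivative is (2 / t) (t^2 + n s / (s - 1)^2). Only the values
  of \<open>f\<close> off 0 and off the ring are prescribed, so the lemma serves with and without a
  centre mass.\<close>

lemma regular_fibre_symmetric_lens:
  fixes f :: "complex \<Rightarrow> complex"
  assumes n: "n > 0"
    and f: "\<And>z. z \<noteq> 0 \<Longrightarrow> z ^ n \<noteq> 1 \<Longrightarrow> f z = z - cnj ((of_real \<epsilon> + 2 * z ^ n / (z ^ n - 1)) / z)"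
    and fin: "finite (radii n \<epsilon> 1)" "finite (radii n \<epsilon> (-1))"
    and transversal: "\<And>\<sigma> t. \<sigma> \<in> {1, -1} \<Longrightarrow> t \<in> radii n \<epsilon> \<sigma> \<Longrightarrow>
      real n * (\<sigma> * t ^ n) + t\<^sup>2 * (\<sigma> * t ^ n - 1)\<^sup>2 \<noteq> 0"
  shows "regular_fibre (- {z. z ^ n = 1} - {0}) f 0
    (n * (card (radii n \<epsilon> 1) + card (radii n \<epsilon> (-1))))"
proof -
  define S where "S = Sigma {1, -1} (radii n \<epsilon>)"
  have S: "finite S" "card S = card (radii n \<epsilon> 1) + card (radii n \<epsilon> (-1))"
    using fin unfolding S_def by (auto simp: card_SigmaI)
  define R where "R = (\<lambda>(\<sigma>, t). {z :: complex. z ^ n = of_real (\<sigma> * t ^ n)})"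
  have R: "finite (R p)" "card (R p) = n" if "p \<in> S" for p
  proof -
    obtain \<sigma> t where p: "p = (\<sigma>, t)"
      by fastforce
    have "of_real (\<sigma> * t ^ n) \<noteq> (0 :: complex)"
      using that unfolding p S_def radii_def by auto
    then show "card (R p) = n" "finite (R p)"
      using card_nth_roots[of "of_real (\<sigma> * t ^ n)" n] finite_nth_roots[of n "of_real (\<sigma> * t ^ n)"] n
      unfolding p R_def by auto
  qed
  have disj: "R p \<inter> R p' = {}" if pp': "p \<in> S" "p' \<in> S" "p \<noteq> p'" for p p'
  proof -
    obtain \<sigma> t \<sigma>' t' where p: "p = (\<sigma>, t)" "p' = (\<sigma>', t')"
      by (metis surj_pair)
    have "False" if z: "z \<in> R p" "z \<in> R p'" for z
    proof -
      have pos: "\<sigma> \<in> {1, -1}" "\<sigma>' \<in> {1, -1}" "t > 0" "t' > 0"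
        using pp' unfolding p S_def radii_def by auto
      have zn: "z ^ n = of_real (\<sigma> * t ^ n)" "z ^ n = of_real (\<sigma>' * t' ^ n)"
        using z unfolding p R_def by auto
      have "t = t'"
        using norm_of_real_root[OF zn(1) pos(1,3) n] norm_of_real_root[OF zn(2) pos(2,4) n] by simp
      moreover have "\<sigma> * t ^ n = \<sigma>' * t' ^ n"
        using zn by (metis of_real_eq_iff)
      ultimately show False
        using pp'(3) pos unfolding p by auto
    qed
    then show ?thesis
      by blast
  qed
  have sol: "z \<in> - {z. z ^ n = 1} - {0} \<and> f z = 0 \<longleftrightarrow> (\<exists>p\<in>S. z \<in> R p)" for z
  proof (cases "z = 0")
    case True
    have "0 \<notin> R p" if "p \<in> S" for p
      using that n unfolding S_def R_def radii_def by (auto simp: zero_power)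
    with True show ?thesis
      by auto
  next
    case False
    have "z \<in> - {z. z ^ n = 1} - {0} \<and> f z = 0 \<longleftrightarrow>
        z ^ n \<noteq> 1 \<and> z - cnj ((of_real \<epsilon> + 2 * z ^ n / (z ^ n - 1)) / z) = 0"
      using f False by auto
    also have "\<dots> \<longleftrightarrow> (\<exists>p\<in>S. z \<in> R p)"
      unfolding lens_equation_iff[OF n False] S_def R_def by auto
    finally show ?thesis .
  qed
  have eq: "{z \<in> - {z. z ^ n = 1} - {0}. f z = 0} = (\<Union>p\<in>S. R p)"
    using sol by blast
  show ?thesis
    unfolding regular_fibre_def eq
  proof (intro conjI ballI impI)
    show "finite (\<Union>p\<in>S. R p)"
      using S(1) R(1) by blast
    have "card (\<Union>p\<in>S. R p) = (\<Sum>p\<in>S. card (R p))"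
      using S(1) R(1) disj by (intro card_UN_disjoint) auto
    then show "card (\<Union>p\<in>S. R p) = n * (card (radii n \<epsilon> 1) + card (radii n \<epsilon> (-1)))"
      using R(2) S(2) by simp
    fix z assume z: "z \<in> - {z. z ^ n = 1} - {0}" "f z = 0"
    then obtain p where p: "p \<in> S" "z \<in> R p"
      using sol[of z] by blast
    obtain \<sigma> t where "p = (\<sigma>, t)"
      by fastforce
    with p have \<sigma>: "\<sigma> \<in> {1, -1}" and t: "t \<in> radii n \<epsilon> \<sigma>" and zn: "z ^ n = of_real (\<sigma> * t ^ n)"
      unfolding S_def R_def by auto
    define s where "s = \<sigma> * t ^ n"
    have t': "t > 0" "s \<noteq> 1" "t\<^sup>2 = \<epsilon> + 2 * s / (s - 1)" "norm z = t" "s \<noteq> 0"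
      using t norm_of_real_root[OF zn \<sigma> _ n] \<sigma> unfolding radii_def s_def by auto
    define r where "r = (\<lambda>z :: complex. (of_real \<epsilon> + 2 * z ^ n / (z ^ n - 1)) / z)"
    define r' where "r' = (- 2 * (of_nat n * z ^ (n - 1)) / (z ^ n - 1)\<^sup>2 * z
      - (of_real \<epsilon> + 2 * z ^ n / (z ^ n - 1))) / (z * z)"
    have z1: "z ^ n - 1 \<noteq> 0" "z \<noteq> 0"
      using z by auto
    have pow: "((\<lambda>z. z ^ n) has_field_derivative of_nat n * z ^ (n - 1)) (at z)"
      by (auto intro!: derivative_eq_intros)
    have "(r has_field_derivative ((0 + (2 * (of_nat n * z ^ (n - 1)) * (z ^ n - 1)
        - 2 * z ^ n * (of_nat n * z ^ (n - 1) - 0)) / ((z ^ n - 1) * (z ^ n - 1))) * z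
        - (of_real \<epsilon> + 2 * z ^ n / (z ^ n - 1)) * 1) / (z * z)) (at z)"
      unfolding r_def using z1
      by (intro DERIV_divide DERIV_add DERIV_diff DERIV_cmult DERIV_const DERIV_ident pow)
    moreover have "0 + (2 * (of_nat n * z ^ (n - 1)) * (z ^ n - 1)
        - 2 * z ^ n * (of_nat n * z ^ (n - 1) - 0)) / ((z ^ n - 1) * (z ^ n - 1))
        = - 2 * (of_nat n * z ^ (n - 1)) / (z ^ n - 1)\<^sup>2"
      by (simp add: power2_eq_square algebra_simps)
    ultimately have "(r has_field_derivative r') (at z)"
      unfolding r'_def by (simp only: mult_1_right)
    moreover have "norm r' \<noteq> 1"
    proof
      have "z ^ (n - 1) * z = z ^ n"
        using n by (metis power_minus_mult)
      then have "- 2 * (of_nat n * z ^ (n - 1)) / (z ^ n - 1)\<^sup>2 * z = - 2 * (of_nat n * z ^ n) / (z ^ n - 1)\<^sup>2"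
        by (simp add: mult.assoc)
      then have "r' = (- 2 * (of_nat n * z ^ n) / (z ^ n - 1)\<^sup>2
          - (of_real \<epsilon> + 2 * z ^ n / (z ^ n - 1))) / (z * z)"
        unfolding r'_def by simp
      also have "\<dots> = of_real (- 2 * (real n * s) / (s - 1)\<^sup>2 - t\<^sup>2) / (z * z)"
        unfolding zn t'(3) s_def[symmetric] by simp
      finally have "norm r' = \<bar>- 2 * (real n * s) / (s - 1)\<^sup>2 - t\<^sup>2\<bar> / t\<^sup>2"
        using t'(4) by (simp only: norm_divide norm_mult norm_of_real power2_eq_square)
      moreover assume "norm r' = 1"
      ultimately have "\<bar>- 2 * (real n * s) / (s - 1)\<^sup>2 - t\<^sup>2\<bar> = t\<^sup>2"
        using t'(1) by (simp add: field_simps)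
      \<comment> \<open>A derivative of modulus 1 leaves two signs: one forces s = 0, the other is
        the equation that \<open>transversal\<close> excludes.\<close>
      then consider "- 2 * (real n * s) / (s - 1)\<^sup>2 = 0" | "- 2 * (real n * s) / (s - 1)\<^sup>2 = 2 * t\<^sup>2"
        by linarith
      then show False
      proof cases
        case 1
        then show ?thesis
          using t' n by auto
      next
        case 2
        then have "real n * s + t\<^sup>2 * (s - 1)\<^sup>2 = 0"
          using t'(2) by (simp add: field_simps)
        then show ?thesis
          using transversal[OF \<sigma> t] by (simp add: s_def)
      qed
    qed
    ultimately have "regular_at (\<lambda>z. z - cnj (r z)) z"
      by (rule regular_at_diff_cnj)
    moreover have "open {z :: complex. z \<noteq> 0 \<and> z ^ n \<noteq> 1}"
      by (intro open_Collect_conj open_Collect_neq continuous_intros)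
    ultimately show "regular_at f z"
      by (rule regular_at_transform) (use z f in \<open>auto simp: r_def\<close>)
  qed
qed

section \<open>Radii of the images\<close>

lemma radii_two: "radii 2 0 1 = {sqrt 3}" "radii 2 0 (-1) = {1}"
proof -
  have "t\<^sup>2 \<noteq> 1 \<and> t\<^sup>2 = 0 + 2 * (1 * t\<^sup>2) / (1 * t\<^sup>2 - 1) \<longleftrightarrow> t = sqrt 3" if "t > 0" for t :: real
  proof -
    have "t\<^sup>2 \<noteq> 1 \<and> t\<^sup>2 = 0 + 2 * (1 * t\<^sup>2) / (1 * t\<^sup>2 - 1) \<longleftrightarrow> t\<^sup>2 \<noteq> 1 \<and> t\<^sup>2 * (t\<^sup>2 - 1) = t\<^sup>2 * 2"
      by (auto simp: field_simps)
    also have "\<dots> \<longleftrightarrow> t\<^sup>2 = 3"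
      using that by auto
    also have "\<dots> \<longleftrightarrow> t = sqrt 3"
      using that by (auto simp: real_sqrt_unique)
    finally show ?thesis .
  qed
  then show "radii 2 0 1 = {sqrt 3}"
    unfolding radii_def by auto
  have "t\<^sup>2 = 0 + 2 * (-1 * t\<^sup>2) / (-1 * t\<^sup>2 - 1) \<longleftrightarrow> t = 1" if "t > 0" for t :: real
  proof -
    have "-1 * t\<^sup>2 - 1 \<noteq> 0"
      by (smt (verit) zero_le_power2)
    then have "t\<^sup>2 = 0 + 2 * (-1 * t\<^sup>2) / (-1 * t\<^sup>2 - 1) \<longleftrightarrow> t\<^sup>2 * (-1 * t\<^sup>2 - 1) = t\<^sup>2 * (-2)"
      by (auto simp: field_simps)
    also have "\<dots> \<longleftrightarrow> -1 * t\<^sup>2 - 1 = -2"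
      using that by (subst mult_left_cancel) simp_all
    also have "\<dots> \<longleftrightarrow> t\<^sup>2 = 1"
      by auto
    also have "\<dots> \<longleftrightarrow> t = 1"
      using that by (auto simp: power2_eq_1_iff)
    finally show ?thesis .
  qed
  moreover have "-1 * t\<^sup>2 \<noteq> 1" for t :: real
    by (smt (verit) zero_le_power2)
  ultimately show "radii 2 0 (-1) = {1}"
    unfolding radii_def by auto
qed

text \<open>After cancelling t^2 the equations are t^3 - 2 t - 1 = (t + 1) (t^2 - t - 1) = 0 and t^3
  - 2 t + 1 = (t - 1) (t^2 + t - 1) = 0, whence the golden ratio and its inverse.\<close>

lemma radii_three:
  "radii 3 0 1 = {(1 + sqrt 5) / 2}" "radii 3 0 (-1) = {1, (sqrt 5 - 1) / 2}"
proof -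
  have s5: "sqrt 5 * sqrt 5 = 5" "sqrt 5 > 1"
    by simp_all
  have "1 * t ^ 3 \<noteq> 1 \<and> t\<^sup>2 = 0 + 2 * (1 * t ^ 3) / (1 * t ^ 3 - 1) \<longleftrightarrow> t = (1 + sqrt 5) / 2"
    if t: "t > 0" for t :: real
  proof -
    have "1 * t ^ 3 \<noteq> 1 \<and> t\<^sup>2 = 0 + 2 * (1 * t ^ 3) / (1 * t ^ 3 - 1) \<longleftrightarrow>
        t ^ 3 \<noteq> 1 \<and> t\<^sup>2 * (t ^ 3 - 1) = t\<^sup>2 * (2 * t)"
      by (auto simp: field_simps power2_eq_square power3_eq_cube)
    also have "\<dots> \<longleftrightarrow> t ^ 3 - 1 = 2 * t"
      using t by auto
    also have "\<dots> \<longleftrightarrow> (t + 1) * ((t - (1 + sqrt 5) / 2) * (t + (sqrt 5 - 1) / 2)) = 0"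
      using s5(1) by (simp add: field_simps power3_eq_cube) argo
    also have "\<dots> \<longleftrightarrow> t = (1 + sqrt 5) / 2"
    proof -
      have "t + (sqrt 5 - 1) / 2 > 0"
        by (intro add_pos_pos t divide_pos_pos) auto
      then show ?thesis
        using t by auto
    qed
    finally show ?thesis .
  qed
  moreover have "(1 + sqrt 5) / 2 > 0"
    by (intro divide_pos_pos add_pos_pos) auto
  ultimately show "radii 3 0 1 = {(1 + sqrt 5) / 2}"
    unfolding radii_def by blast
  have iff: "t\<^sup>2 = 0 + 2 * (-1 * t ^ 3) / (-1 * t ^ 3 - 1) \<longleftrightarrow> t = 1 \<or> t = (sqrt 5 - 1) / 2"
    if t: "t > 0" for t :: real
  proof -
    have "-1 * t ^ 3 - 1 \<noteq> 0"
      using zero_less_power[OF t, of 3] by linarith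
    then have "t\<^sup>2 = 0 + 2 * (-1 * t ^ 3) / (-1 * t ^ 3 - 1) \<longleftrightarrow> t\<^sup>2 * (t ^ 3 + 1) = t\<^sup>2 * (2 * t)"
      by (auto simp: field_simps power2_eq_square power3_eq_cube)
    also have "\<dots> \<longleftrightarrow> t ^ 3 + 1 = 2 * t"
      using t by auto
    also have "\<dots> \<longleftrightarrow> (t - 1) * ((t - (sqrt 5 - 1) / 2) * (t + (1 + sqrt 5) / 2)) = 0"
      using s5(1) by (simp add: field_simps power3_eq_cube) argo
    also have "\<dots> \<longleftrightarrow> t = 1 \<or> t = (sqrt 5 - 1) / 2"
    proof -
      have "t + (1 + sqrt 5) / 2 > 0"
        by (intro add_pos_pos t divide_pos_pos) auto
      then show ?thesis
        by auto
    qed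
    finally show ?thesis .
  qed
  show "radii 3 0 (-1) = {1, (sqrt 5 - 1) / 2}"
  proof (rule Set.set_eqI)
    fix t :: real
    show "t \<in> radii 3 0 (-1) \<longleftrightarrow> t \<in> {1, (sqrt 5 - 1) / 2}"
    proof (cases "t > 0")
      case True
      moreover have "-1 * t ^ 3 \<noteq> 1"
        using zero_less_power[OF True, of 3] by linarith
      ultimately show ?thesis
        using iff[OF True] unfolding radii_def mem_Collect_eq insert_iff empty_iff by blast
    next
      case False
      have pos: "(sqrt 5 - 1) / 2 > 0"
        by simp
      have "t \<noteq> 1" "t \<noteq> (sqrt 5 - 1) / 2"
        using False by (simp, metis False pos)
      with False show ?thesis
        unfolding radii_def by simp
    qed
  qed
qed

section \<open>Counting the radii in the presence of a centre mass\<close>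

definition radial :: "nat \<Rightarrow> real \<Rightarrow> real \<Rightarrow> real \<Rightarrow> real" where
  "radial n \<epsilon> \<sigma> t = (t\<^sup>2 - \<epsilon>) * (t ^ n - \<sigma>) - 2 * t ^ n"

text \<open>Clearing the denominator and multiplying by \<sigma> adds no zero: where t^n = \<sigma>,
  \<open>radial\<close> is -2 t^n, which is not 0.\<close>

lemma radii_iff_radial:
  assumes "\<sigma> \<in> {1, -1}"
  shows "t \<in> radii n \<epsilon> \<sigma> \<longleftrightarrow> t > 0 \<and> radial n \<epsilon> \<sigma> t = 0"
proof (cases "t > 0 \<and> \<sigma> * t ^ n \<noteq> 1")
  case True
  have sq: "\<sigma> * \<sigma> = 1"
    using assms by auto
  have "t\<^sup>2 = \<epsilon> + 2 * (\<sigma> * t ^ n) / (\<sigma> * t ^ n - 1) \<longleftrightarrow>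
      (t\<^sup>2 - \<epsilon>) * (\<sigma> * t ^ n - 1) = 2 * (\<sigma> * t ^ n)"
    using True by (auto simp: field_simps)
  also have "\<dots> \<longleftrightarrow> \<sigma> * ((t\<^sup>2 - \<epsilon>) * (\<sigma> * t ^ n - 1)) = \<sigma> * (2 * (\<sigma> * t ^ n))"
    using assms by auto
  also have "\<dots> \<longleftrightarrow> (t\<^sup>2 - \<epsilon>) * (\<sigma> * \<sigma> * t ^ n - \<sigma>) = 2 * (\<sigma> * \<sigma> * t ^ n)"
    by (simp add: algebra_simps)
  also have "\<dots> \<longleftrightarrow> radial n \<epsilon> \<sigma> t = 0"
    by (simp add: radial_def sq)
  finally show ?thesis
    using True by (simp add: radii_def)
next
  case False
  then have "t > 0 \<Longrightarrow> t ^ n = \<sigma>"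
    using assms by auto
  then have "t > 0 \<Longrightarrow> radial n \<epsilon> \<sigma> t \<noteq> 0"
    using zero_less_power[of t n] by (auto simp: radial_def)
  with False show ?thesis
    by (auto simp: radii_def)
qed

lemma isCont_radial: "isCont (radial n \<epsilon> \<sigma>) t"
  unfolding radial_def[abs_def] by (intro continuous_intros)

lemma IVT_sign_change:
  fixes f :: "real \<Rightarrow> real"
  assumes "a < b" "\<And>x. isCont f x" "f a * f b < 0"
  obtains x where "a < x" "x < b" "f x = 0"
proof -
  have "\<exists>x. a \<le> x \<and> x \<le> b \<and> f x = 0"
  proof (cases "f a < 0")
    case True
    then show ?thesis
      using IVT[of f a 0 b] assms by (auto simp: mult_less_0_iff)
  next
    case False
    then show ?thesis
      using IVT2[of f b 0 a] assms by (auto simp: mult_less_0_iff)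
  qed
  then obtain x where x: "a \<le> x" "x \<le> b" "f x = 0"
    by blast
  moreover have "x \<noteq> a" "x \<noteq> b"
    using assms(3) x(3) by auto
  ultimately show thesis
    using that by force
qed

lemma power_quarter_le: "n \<ge> 3 \<Longrightarrow> (1 / 4 :: real) ^ n \<le> 1 / 64"
  using power_decreasing[of 3 n "1 / 4 :: real"] by (simp add: power3_eq_cube)

lemma power_two_ge: "n \<ge> 3 \<Longrightarrow> (2 :: real) ^ n \<ge> 8"
  using power_increasing[of 3 n "2 :: real"] by simp

text \<open>In the form t^2 = \<epsilon> + 2 + 2 / (t^n - 1) the left side increases and the right
  side decreases on either side of t = 1, so each side carries at most one radius. Sign changes on
  (0, 1) and (1, 2) supply one each.\<close>

lemma radii_plus:
  assumes n: "n \<ge> 3"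
  shows "\<exists>a b. a \<noteq> b \<and> radii n (1 / 32) 1 = {a, b}"
proof -
  let ?p = "radial n (1 / 32) 1"
  have vals: "?p 0 > 0" "?p 1 < 0" "?p 2 > 0"
    using n power_two_ge[OF n] by (auto simp: radial_def field_simps zero_power)
  obtain a where a: "0 < a" "a < 1" "?p a = 0"
    using IVT_sign_change[of 0 1 ?p] isCont_radial vals by (auto simp: mult_less_0_iff)
  obtain b where b: "1 < b" "b < 2" "?p b = 0"
    using IVT_sign_change[of 1 2 ?p] isCont_radial vals by (auto simp: mult_less_0_iff)
  have ab: "a \<in> radii n (1 / 32) 1" "b \<in> radii n (1 / 32) 1"
    using a b by (auto simp: radii_iff_radial)
  have no_two: False if xy: "x < y" "x \<in> radii n (1 / 32) 1" "y \<in> radii n (1 / 32) 1" "y < 1 \<or> 1 < x" for x y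
  proof -
    have pos: "x > 0" "y > 0" and ne: "x ^ n \<noteq> 1" "y ^ n \<noteq> 1"
      and eq: "x\<^sup>2 = 1 / 32 + 2 * x ^ n / (x ^ n - 1)" "y\<^sup>2 = 1 / 32 + 2 * y ^ n / (y ^ n - 1)"
      using xy(2,3) by (auto simp: radii_def)
    have "x\<^sup>2 = 1 / 32 + 2 + 2 / (x ^ n - 1)" "y\<^sup>2 = 1 / 32 + 2 + 2 / (y ^ n - 1)"
      using ne unfolding eq by (auto simp: field_simps)
    moreover have "x\<^sup>2 < y\<^sup>2" and pow: "x ^ n < y ^ n"
      using pos xy(1) n by (auto intro!: power_strict_mono)
    moreover have "2 / (y ^ n - 1) < 2 / (x ^ n - 1)"
    proof (cases "1 < x")
      case True
      then have "x ^ n > 1"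
        using n by (intro one_less_power) auto
      then show ?thesis
        using pow by (intro divide_strict_left_mono mult_pos_pos) auto
    next
      case False
      then have "y ^ n < 1"
        using xy(4) pos n power_strict_mono[of y 1 n] by auto
      then show ?thesis
        using pow by (intro divide_strict_left_mono mult_neg_neg) auto
    qed
    ultimately show False
      by linarith
  qed
  have "t = a \<or> t = b" if t: "t \<in> radii n (1 / 32) 1" for t
  proof -
    have "t \<noteq> 1"
      using t by (auto simp: radii_def)
    then consider "t < 1" | "1 < t"
      by linarith
    then show ?thesis
    proof cases
      case 1
      then show ?thesis
        using no_two[of t a] no_two[of a t] t a ab by (cases t a rule: linorder_cases) auto
    next
      case 2
      then show ?thesis
        using no_two[of t b] no_two[of b t] t b ab by (cases t b rule: linorder_cases) auto
    qed
  qed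
  then have "radii n (1 / 32) 1 = {a, b}"
    using ab by auto
  with a b show ?thesis
    by (intro exI[of _ a] exI[of _ b]) auto
qed

text \<open>\<open>t\<^sup>3\<close> times the derivative of \<open>radial n \<epsilon> (-1) t / t\<^sup>2\<close>.\<close>

definition radial_slope :: "nat \<Rightarrow> real \<Rightarrow> real \<Rightarrow> real" where
  "radial_slope n \<epsilon> t = real n * (t\<^sup>2 * t ^ n) - (real n - 2) * (\<epsilon> + 2) * t ^ n + 2 * \<epsilon>"

text \<open>For \<sigma> = -1 the polynomial has four monomials. Division by t^2 makes one of them
  constant, so that the derivative has only three: Descartes' rule of signs carried out with Rolle's
  theorem.\<close>

lemma DERIV_radial_over_square:
  assumes "t > 0" "n > 0"
  shows "((\<lambda>t. radial n \<epsilon> (-1) t / t\<^sup>2) has_real_derivative radial_slope n \<epsilon> t / t ^ 3) (at t)"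
proof -
  have "t ^ n = t * t ^ (n - 1)"
    using assms by (metis power_eq_if not_gr_zero)
  then show ?thesis
    unfolding radial_def radial_slope_def using assms
    by (auto intro!: derivative_eq_intros)
      (simp add: field_simps power2_eq_square power3_eq_cube power4_eq_xxxx)
qed

lemma radial_slope_between:
  assumes "0 < a" "a < b" "radial n \<epsilon> (-1) a = 0" "radial n \<epsilon> (-1) b = 0" "n > 0"
  obtains x where "a < x" "x < b" "radial_slope n \<epsilon> x = 0"
proof -
  let ?q = "\<lambda>t. radial n \<epsilon> (-1) t / t\<^sup>2"
  have der: "(?q has_real_derivative radial_slope n \<epsilon> t / t ^ 3) (at t)" if "a \<le> t" for t
    using that assms by (intro DERIV_radial_over_square) auto
  have "\<exists>z>a. z < b \<and> (?q has_real_derivative 0) (at z)"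
  proof (rule Rolle)
    show "continuous_on {a..b} ?q"
      by (intro continuous_at_imp_continuous_on ballI) (use der DERIV_isCont in force)
    show "?q differentiable (at x)" if "a < x" "x < b" for x
      using der that unfolding real_differentiable_def by (meson less_imp_le)
  qed (use assms in auto)
  then obtain z where z: "a < z" "z < b" "(?q has_real_derivative 0) (at z)"
    by blast
  then have "radial_slope n \<epsilon> z / z ^ 3 = 0"
    using DERIV_unique[OF der z(3)] by simp
  then show thesis
    using that z assms(1) by simp
qed

text \<open>Differentiating removes the constant 2 \<epsilon> and leaves multiples of t^(n+1) and
  t^(n-1), which have at most one common positive cancellation point; by Rolle the slope has at most
  two positive zeros.\<close>

lemma radial_slope_no_three_zeros:
  assumes "0 < a" "a < b" "b < c" "n > 0"
    and "radial_slope n \<epsilon> a = 0" "radial_slope n \<epsilon> b = 0" "radial_slope n \<epsilon> c = 0"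
  shows False
proof -
  let ?d = "\<lambda>t. real n * ((real n + 2) * t\<^sup>2 - (real n - 2) * (\<epsilon> + 2)) * t ^ (n - 1)"
  have der: "(radial_slope n \<epsilon> has_real_derivative ?d t) (at t)" for t
  proof -
    have "t ^ n = t * t ^ (n - 1)"
      using assms(4) by (metis power_eq_if not_gr_zero)
    then show ?thesis
      unfolding radial_slope_def[abs_def]
      by (auto intro!: derivative_eq_intros) (simp add: algebra_simps power2_eq_square)
  qed
  have rolle: "\<exists>z. x < z \<and> z < y \<and> ?d z = 0"
    if "x < y" "radial_slope n \<epsilon> x = 0" "radial_slope n \<epsilon> y = 0" for x y
  proof -
    have "\<exists>z>x. z < y \<and> (radial_slope n \<epsilon> has_real_derivative 0) (at z)"
      using that der
      by (intro Rolle continuous_at_imp_continuous_on ballI)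
        (auto intro: DERIV_isCont simp: real_differentiable_def)
    then show ?thesis
      using DERIV_unique[OF der] by blast
  qed
  obtain u v where uv: "a < u" "u < b" "?d u = 0" "b < v" "v < c" "?d v = 0"
    using rolle[of a b] rolle[of b c] assms by blast
  then have pos: "0 < u" "u < v"
    using assms by auto
  then have "(real n + 2) * u\<^sup>2 = (real n - 2) * (\<epsilon> + 2)" "(real n + 2) * v\<^sup>2 = (real n - 2) * (\<epsilon> + 2)"
    using uv(3,6) assms(4) by auto
  then have "(real n + 2) * u\<^sup>2 = (real n + 2) * v\<^sup>2"
    by simp
  then have "u\<^sup>2 = v\<^sup>2"
    by simp
  then show False
    using pos by (simp add: power2_eq_iff)
qed

text \<open>The condition \<open>tangent\<close> means that t is a double zero of
  \<open>radial\<close>, hence also of its quotient by t^2. The proof eliminates t^n algebraically,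
  using both equations.\<close>

lemma radial_slope_eq_0:
  assumes t: "t \<in> radii n \<epsilon> (-1)" and n: "n > 0"
    and tangent: "real n * (-1 * t ^ n) + t\<^sup>2 * (-1 * t ^ n - 1)\<^sup>2 = 0"
  shows "radial_slope n \<epsilon> t = 0"
proof -
  define x where "x = t ^ n"
  have x: "x > 0"
    using t by (simp add: x_def radii_def)
  have 1: "(t\<^sup>2 - \<epsilon>) * (x + 1) = 2 * x"
    using t unfolding radii_iff_radial[of "-1", simplified] by (simp add: radial_def x_def)
  have 2: "real n * x = t\<^sup>2 * (x + 1)\<^sup>2"
    using tangent unfolding x_def[symmetric] by (simp add: power2_eq_square algebra_simps)
  have "(x + 1) * radial_slope n \<epsilon> t = (real n * x) * ((t\<^sup>2 - \<epsilon>) * (x + 1) - 2 * (x + 1))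
      + (x + 1) * (2 * (\<epsilon> + 2) * x + 2 * \<epsilon>)"
    unfolding radial_slope_def x_def[symmetric] by (simp add: algebra_simps)
  also have "\<dots> = (x + 1) * (- 2 * t\<^sup>2 * (x + 1) + 2 * \<epsilon> * (x + 1) + 2 * (2 * x))"
    unfolding 1 2 by (simp add: algebra_simps power2_eq_square)
  also have "\<dots> = 0"
    unfolding 1[symmetric] by (simp add: algebra_simps)
  finally show ?thesis
    using x by simp
qed

text \<open>Four radii would give three zeros of the slope. So would three radii of which one is a
  double zero: that one together with a zero in each of the two gaps.\<close>

lemma radii_minus:
  assumes n: "n \<ge> 3"
  shows "card (radii n (1 / 32) (-1)) = 3" (is ?A)
    "t \<in> radii n (1 / 32) (-1) \<Longrightarrow>
      real n * (-1 * t ^ n) + t\<^sup>2 * (-1 * t ^ n - 1)\<^sup>2 \<noteq> 0" (is "_ \<Longrightarrow> ?B t")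
proof -
  let ?p = "radial n (1 / 32) (-1)" and ?s = "radial_slope n (1 / 32)"
  have n0: "n > 0"
    using n by simp
  \<comment> \<open>These signs explain 1/32. At 1/4, with x = (1/4)^n \<le> 1/64, the value is (1 +
    x) / 32 - 2 x, which is still positive for n = 3. At 1 it is -2 \<epsilon>, negative only thanks
    to the centre mass; for n = 4 and \<epsilon> = 0 there would be a double zero there.\<close>
  have vals: "?p 0 < 0" "?p (1 / 4) > 0" "?p 1 < 0" "?p 2 > 0"
    using n power_two_ge[OF n] power_quarter_le[OF n]
    by (auto simp: radial_def field_simps zero_power power2_eq_square)
  obtain a where a: "0 < a" "a < 1 / 4" "?p a = 0"
    using IVT_sign_change[of 0 "1 / 4" ?p] isCont_radial vals by (auto simp: mult_less_0_iff)
  obtain b where b: "1 / 4 < b" "b < 1" "?p b = 0"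
    using IVT_sign_change[of "1 / 4" 1 ?p] isCont_radial vals by (auto simp: mult_less_0_iff)
  obtain c where c: "1 < c" "c < 2" "?p c = 0"
    using IVT_sign_change[of 1 2 ?p] isCont_radial vals by (auto simp: mult_less_0_iff)
  have ord: "0 < a" "a < b" "b < c"
    using a b c by auto
  have between: "\<exists>u. x < u \<and> u < y \<and> ?s u = 0" if "0 < x" "x < y" "?p x = 0" "?p y = 0" for x y
    using radial_slope_between[OF that n0] by blast
  note no3 = radial_slope_no_three_zeros[of _ _ _ n "1 / 32", OF _ _ _ n0]
  have no4: False if w4: "0 < w" "w < x" "x < y" "y < z" "?p w = 0" "?p x = 0" "?p y = 0" "?p z = 0" for w x y z
  proof -
    have "0 < x" "0 < y"
      using w4 by auto
    then obtain u1 u2 u3 where "w < u1" "u1 < x" "?s u1 = 0" "x < u2" "u2 < y" "?s u2 = 0"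
      "y < u3" "u3 < z" "?s u3 = 0"
      using between[of w x] between[of x y] between[of y z] w4 by blast
    then show False
      using no3[of u1 u2 u3] \<open>0 < w\<close> by simp
  qed
  have only: "t = a \<or> t = b \<or> t = c" if t: "t > 0" "?p t = 0" for t
  proof (rule ccontr)
    assume "\<not> ?thesis"
    then consider "t < a" | "a < t" "t < b" | "b < t" "t < c" | "c < t"
      by linarith
    then show False
      using no4[of t a b c] no4[of a t b c] no4[of a b t c] no4[of a b c t] t ord a b c
      by cases auto
  qed
  have mem: "t \<in> radii n (1 / 32) (-1) \<longleftrightarrow> t > 0 \<and> ?p t = 0" for t
    by (rule radii_iff_radial) simp
  have "0 < b" "0 < c"
    using ord by auto
  then have eq: "radii n (1 / 32) (-1) = {a, b, c}"
    using only mem a b c by blast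
  then show ?A
    using ord by simp
  assume t: "t \<in> radii n (1 / 32) (-1)"
  show "?B t"
  proof
    assume "real n * (-1 * t ^ n) + t\<^sup>2 * (-1 * t ^ n - 1)\<^sup>2 = 0"
    then have st: "?s t = 0"
      using radial_slope_eq_0[OF t n0] by blast
    \<comment> \<open>\<open>u\<close> and \<open>v\<close> lie strictly between the radii, so a
      tangential radius would be a third zero of the slope.\<close>
    obtain u v where uv: "a < u" "u < b" "?s u = 0" "b < v" "v < c" "?s v = 0"
      using between[of a b] between[of b c] ord a b c by auto
    consider "t = a" | "t = b" | "t = c"
      using t eq by blast
    then show False
      using no3[of a u v] no3[of u b v] no3[of u v c] uv ord st by cases auto
  qed
qed

section \<open>Single-plane lenses with the maximal number of images\<close>

lemma ring_deflection:
  assumes n: "n > 0" and \<xi>: "bij_betw \<xi> {1..n} {w :: complex. w ^ n = 1}" and z: "z ^ n \<noteq> 1"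
  shows "(\<Sum>l = 1..n. of_real (2 / real n) * inverse (z - \<xi> l)) = 2 * z ^ (n - 1) / (z ^ n - 1)"
proof -
  have "(\<Sum>l = 1..n. of_real (2 / real n) * inverse (z - \<xi> l)) =
      of_real (2 / real n) * (\<Sum>l = 1..n. inverse (z - \<xi> l))"
    by (simp only: sum_distrib_left)
  also have "(\<Sum>l = 1..n. inverse (z - \<xi> l)) = (\<Sum>w | w ^ n = 1. inverse (z - w))"
    by (rule sum.reindex_bij_betw[OF \<xi>])
  also have "\<dots> = of_nat n * z ^ (n - 1) / (z ^ n - 1)"
    by (rule sum_inverse_roots_unity[OF n z])
  finally show ?thesis
    using n by simp
qed

lemma ring_deflection_alt:
  fixes z :: complex
  assumes "n > 0" "z \<noteq> 0"
  shows "2 * z ^ (n - 1) / (z ^ n - 1) = (2 * z ^ n / (z ^ n - 1)) / z"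
  using assms by (cases n) auto

lemma ex_roots_unity_enumeration:
  assumes "n > 0"
  obtains \<xi> where "bij_betw \<xi> {1..n} {w :: complex. w ^ n = 1}"
proof -
  have "finite {w :: complex. w ^ n = 1}" "card {w :: complex. w ^ n = 1} = n"
    using assms by (auto intro: card_roots_unity_eq finite_roots_unity)
  then show thesis
    using that ex_bij_betw_nat_finite_1[of "{w :: complex. w ^ n = 1}"] by auto
qed

text \<open>The summand 1 is the image at the centre, where the ring's deflection vanishes by
  symmetry.\<close>

lemma regular_fibre_ring:
  assumes n: "n \<ge> 2" and \<xi>: "bij_betw \<xi> {1..n} {w :: complex. w ^ n = 1}"
    and fin: "finite (radii n 0 1)" "finite (radii n 0 (-1))"
    and transversal: "\<And>\<sigma> t. \<sigma> \<in> {1, -1} \<Longrightarrow> t \<in> radii n 0 \<sigma> \<Longrightarrow>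
      real n * (\<sigma> * t ^ n) + t\<^sup>2 * (\<sigma> * t ^ n - 1)\<^sup>2 \<noteq> 0"
  shows "regular_fibre (- \<xi> ` {1..n}) (point_lens n (\<lambda>_. 2 / real n) \<xi>) 0
    (n * (card (radii n 0 1) + card (radii n 0 (-1))) + 1)"
proof -
  have n0: "n > 0"
    using n by simp
  have poles: "- \<xi> ` {1..n} = - {z. z ^ n = 1}"
    using bij_betw_imp_surj_on[OF \<xi>] by simp
  let ?f = "point_lens n (\<lambda>_. 2 / real n) \<xi>" and ?r = "\<lambda>z :: complex. 2 * z ^ (n - 1) / (z ^ n - 1)"
  have f: "?f z = z - cnj (?r z)" if "z ^ n \<noteq> 1" for z
    unfolding point_lens_complex ring_deflection[OF n0 \<xi> that] ..
  show ?thesis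
    unfolding poles
  proof (rule regular_fibre_insert)
    show "regular_fibre (- {z. z ^ n = 1} - {0}) ?f 0 (n * (card (radii n 0 1) + card (radii n 0 (-1))))"
    proof (rule regular_fibre_symmetric_lens[OF n0 _ fin transversal])
      show "?f z = z - cnj ((of_real 0 + 2 * z ^ n / (z ^ n - 1)) / z)" if "z \<noteq> 0" "z ^ n \<noteq> 1" for z
        using f[OF that(2)] unfolding ring_deflection_alt[OF n0 that(1)] by simp
    qed
    show "0 \<in> - {z :: complex. z ^ n = 1}"
      using n0 by (simp add: zero_power)
    show "?f 0 = 0"
      using f[of 0] n by (simp add: zero_power)
    have "((\<lambda>z :: complex. z ^ k) has_field_derivative of_nat k * 0 ^ (k - 1)) (at 0)" for k
      by (auto intro!: derivative_eq_intros)
    note pow = this[of n] this[of "n - 1"]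
    have "(?r has_field_derivative (2 * (of_nat (n - 1) * 0 ^ (n - 1 - 1)) * (0 ^ n - 1)
        - 2 * 0 ^ (n - 1) * (of_nat n * 0 ^ (n - 1) - 0)) / ((0 ^ n - 1) * (0 ^ n - 1))) (at 0)"
      using n0 by (intro DERIV_divide DERIV_diff DERIV_cmult DERIV_const pow) (simp add: zero_power)
    \<comment> \<open>The derivative at the centre is -2 for n = 2 and 0 for n > 2.\<close>
    moreover have "norm ((2 * (of_nat (n - 1) * 0 ^ (n - 1 - 1)) * (0 ^ n - 1)
        - 2 * 0 ^ (n - 1) * (of_nat n * 0 ^ (n - 1) - 0)) / ((0 ^ n - 1) * (0 ^ n - 1)) :: complex) \<noteq> 1"
      using n by (cases "n = 2") (auto simp: zero_power)
    ultimately have "regular_at (\<lambda>z. z - cnj (?r z)) 0"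
      by (rule regular_at_diff_cnj)
    moreover have "open {z :: complex. z ^ n \<noteq> 1}"
      by (intro open_Collect_neq continuous_intros)
    ultimately show "regular_at ?f 0"
      by (rule regular_at_transform) (use f n0 in \<open>auto simp: zero_power\<close>)
  qed
qed

lemma regular_fibre_ring_with_centre:
  assumes n: "n > 0" and \<xi>: "bij_betw \<xi> {1..n} {w :: complex. w ^ n = 1}"
    and fin: "finite (radii n \<epsilon> 1)" "finite (radii n \<epsilon> (-1))"
    and transversal: "\<And>\<sigma> t. \<sigma> \<in> {1, -1} \<Longrightarrow> t \<in> radii n \<epsilon> \<sigma> \<Longrightarrow>
      real n * (\<sigma> * t ^ n) + t\<^sup>2 * (\<sigma> * t ^ n - 1)\<^sup>2 \<noteq> 0"
  shows "regular_fibre (- (\<xi>(n + 1 := 0)) ` {1..n + 1})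
    (point_lens (n + 1) ((\<lambda>_. 2 / real n)(n + 1 := \<epsilon>)) (\<xi>(n + 1 := 0))) 0
    (n * (card (radii n \<epsilon> 1) + card (radii n \<epsilon> (-1))))"
proof -
  let ?f = "point_lens (n + 1) ((\<lambda>_. 2 / real n)(n + 1 := \<epsilon>)) (\<xi>(n + 1 := 0))"
  have "(\<xi>(n + 1 := 0)) ` {1..n + 1} = insert 0 (\<xi> ` {1..n})"
    by (auto simp: image_iff atLeastAtMostSuc_conv)
  then have poles: "- (\<xi>(n + 1 := 0)) ` {1..n + 1} = - {z. z ^ n = 1} - {0}"
    using bij_betw_imp_surj_on[OF \<xi>] by auto
  have f: "?f z = z - cnj ((of_real \<epsilon> + 2 * z ^ n / (z ^ n - 1)) / z)" if z: "z \<noteq> 0" "z ^ n \<noteq> 1" for z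
  proof -
    have "(\<Sum>l = 1..n + 1. of_real (((\<lambda>_. 2 / real n)(n + 1 := \<epsilon>)) l) * inverse (z - (\<xi>(n + 1 := 0)) l)) =
        (\<Sum>l = 1..n. of_real (2 / real n) * inverse (z - \<xi> l)) + of_real \<epsilon> * inverse z"
      by simp
    also have "\<dots> = (of_real \<epsilon> + 2 * z ^ n / (z ^ n - 1)) / z"
      unfolding ring_deflection[OF n \<xi> z(2)] ring_deflection_alt[OF n z(1)]
      by (simp add: divide_inverse distrib_right)
    finally show ?thesis
      by (simp only: point_lens_complex)
  qed
  show ?thesis
    unfolding poles by (rule regular_fibre_symmetric_lens[OF n f fin transversal])
qed

lemma exists_complex_lens:
  assumes g: "g \<ge> 2"
  shows "\<exists>(c :: nat \<Rightarrow> real) (\<xi> :: nat \<Rightarrow> complex). inj_on \<xi> {1..g} \<and> (\<forall>l\<in>{1..g}. c l > 0) \<and>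
    regular_fibre (- \<xi> ` {1..g}) (point_lens g c \<xi>) 0 (5 * g - 5)"
proof -
  consider "g = 2" | "g = 3" | "g \<ge> 4"
    using g by linarith
  then show ?thesis
  proof cases
    case 1
    obtain \<xi> where \<xi>: "bij_betw \<xi> {1..2 :: nat} {w :: complex. w ^ 2 = 1}"
      by (rule ex_roots_unity_enumeration[of 2]) simp
    have "regular_fibre (- \<xi> ` {1..2}) (point_lens 2 (\<lambda>_. 2 / real 2) \<xi>) 0
        (2 * (card (radii 2 0 1) + card (radii 2 0 (-1))) + 1)"
      by (rule regular_fibre_ring[OF _ \<xi>]) (auto simp: radii_two)
    then have "regular_fibre (- \<xi> ` {1..2}) (point_lens 2 (\<lambda>_. 2 / real 2) \<xi>) 0 5"
      by (simp add: radii_two)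
    with 1 \<xi> show ?thesis
      by (intro exI[of _ "\<lambda>_. 2 / real 2"] exI[of _ \<xi>]) (auto dest: bij_betw_imp_inj_on)
  next
    case 2
    obtain \<xi> where \<xi>: "bij_betw \<xi> {1..3 :: nat} {w :: complex. w ^ 3 = 1}"
      by (rule ex_roots_unity_enumeration[of 3]) simp
    define \<tau> where "\<tau> = (sqrt 5 - 1) / 2"
    have s5: "sqrt 5 * sqrt 5 = 5" "sqrt 5 > 1"
      by simp_all
    have \<tau>: "\<tau>\<^sup>2 = 1 - \<tau>" "\<tau> > 0"
      using s5 by (auto simp: \<tau>_def field_simps power2_eq_square)
    have \<tau>3: "\<tau> ^ 3 = 2 * \<tau> - 1"
    proof -
      have "\<tau> ^ 3 = \<tau> * (1 - \<tau>)"
        by (simp add: power3_eq_cube \<tau>(1)[symmetric] power2_eq_square)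
      then show ?thesis
        using \<tau>(1) by (simp add: algebra_simps power2_eq_square)
    qed
    have tau_transversal: "real 3 * (-1 * \<tau> ^ 3) + \<tau>\<^sup>2 * (-1 * \<tau> ^ 3 - 1)\<^sup>2 \<noteq> 0"
    proof
      assume 0: "real 3 * (-1 * \<tau> ^ 3) + \<tau>\<^sup>2 * (-1 * \<tau> ^ 3 - 1)\<^sup>2 = 0"
      have "-1 * \<tau> ^ 3 - 1 = - 2 * \<tau>"
        using \<tau>3 by simp
      then have sq: "(-1 * \<tau> ^ 3 - 1)\<^sup>2 = 4 * \<tau>\<^sup>2"
        by (simp only:) (simp add: power_mult_distrib)
      \<comment> \<open>The powers reduce by \<tau>^3 = 2 \<tau> - 1, so tangency would mean \<tau>
        = 3/4, which is not a root of \<tau>^2 = 1 - \<tau>.\<close>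
      have "real 3 * (-1 * \<tau> ^ 3) + \<tau>\<^sup>2 * (-1 * \<tau> ^ 3 - 1)\<^sup>2 = \<tau> ^ 3 * (4 * \<tau> - 3)"
        unfolding sq by (simp add: power3_eq_cube power2_eq_square algebra_simps)
      with 0 have "\<tau> = 3 / 4"
        using \<tau>(2) by simp
      from \<tau>(1)[unfolded this] show False
        by (simp add: power2_eq_square)
    qed
    have transversal: "real 3 * (\<sigma> * t ^ 3) + t\<^sup>2 * (\<sigma> * t ^ 3 - 1)\<^sup>2 \<noteq> 0"
      if "\<sigma> \<in> {1, -1}" "t \<in> radii 3 0 \<sigma>" for \<sigma> t
    proof (cases "\<sigma> = 1")
      case True
      have "t > 0"
        using that by (simp add: radii_def)
      then show ?thesis
        using True by (intro less_imp_neq[THEN not_sym] add_pos_nonneg) auto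
    next
      case False
      then have \<sigma>: "\<sigma> = -1"
        using that by simp
      then have "t = 1 \<or> t = \<tau>"
        using that radii_three(2) unfolding \<tau>_def by blast
      then show ?thesis
        using tau_transversal unfolding \<sigma> by (elim disjE) simp_all
    qed
    have "regular_fibre (- \<xi> ` {1..3}) (point_lens 3 (\<lambda>_. 2 / real 3) \<xi>) 0
        (3 * (card (radii 3 0 1) + card (radii 3 0 (-1))) + 1)"
      by (rule regular_fibre_ring[OF _ \<xi> _ _ transversal]) (simp_all add: radii_three)
    moreover have "card (radii 3 0 1) = 1" "card (radii 3 0 (-1)) = 2"
    proof -
      have "(sqrt 5 - 1) / 2 \<noteq> 1"
        using \<tau>(1) unfolding \<tau>_def[symmetric] by auto
      then show "card (radii 3 0 1) = 1" "card (radii 3 0 (-1)) = 2"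
        unfolding radii_three by auto
    qed
    ultimately have "regular_fibre (- \<xi> ` {1..3}) (point_lens 3 (\<lambda>_. 2 / real 3) \<xi>) 0 10"
      by simp
    with 2 \<xi> show ?thesis
      by (intro exI[of _ "\<lambda>_. 2 / real 3"] exI[of _ \<xi>]) (auto dest: bij_betw_imp_inj_on)
  next
    case 3
    define n where "n = g - 1"
    have n: "n \<ge> 3" "n > 0" "g = n + 1"
      using 3 by (auto simp: n_def)
    obtain \<xi> where \<xi>: "bij_betw \<xi> {1..n} {w :: complex. w ^ n = 1}"
      by (rule ex_roots_unity_enumeration[OF n(2)])
    have plus: "card (radii n (1 / 32) 1) = 2" "finite (radii n (1 / 32) 1)"
      using radii_plus[OF n(1)] by auto
    have minus: "card (radii n (1 / 32) (-1)) = 3" "finite (radii n (1 / 32) (-1))"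
      using radii_minus(1)[OF n(1)] by (auto intro: card_ge_0_finite)
    have "real n * (\<sigma> * t ^ n) + t\<^sup>2 * (\<sigma> * t ^ n - 1)\<^sup>2 \<noteq> 0"
      if "\<sigma> \<in> {1, -1}" "t \<in> radii n (1 / 32) \<sigma>" for \<sigma> t
    proof (cases "\<sigma> = 1")
      case True
      have "t > 0"
        using that by (simp add: radii_def)
      then show ?thesis
        using True n by (intro less_imp_neq[THEN not_sym] add_pos_nonneg) auto
    next
      case False
      then show ?thesis
        using radii_minus(2)[OF n(1)] that by auto
    qed
    then have "regular_fibre (- (\<xi>(n + 1 := 0)) ` {1..n + 1})
        (point_lens (n + 1) ((\<lambda>_. 2 / real n)(n + 1 := 1 / 32)) (\<xi>(n + 1 := 0))) 0 (n * (2 + 3))"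
      using regular_fibre_ring_with_centre[OF n(2) \<xi> plus(2) minus(2)] plus(1) minus(1) by auto
    moreover have "n * (2 + 3) = 5 * g - 5"
      using n(3) by simp
    moreover have "inj_on (\<xi>(n + 1 := 0)) {1..g}"
    proof -
      have "0 \<notin> \<xi> ` {1..n}"
        using bij_betw_imp_surj_on[OF \<xi>] n(2) by (auto simp: zero_power)
      moreover have "inj_on (\<xi>(n + 1 := 0)) {1..n} \<longleftrightarrow> inj_on \<xi> {1..n}"
        by (rule inj_on_cong) simp
      moreover have "(\<xi>(n + 1 := 0)) ` {1..n} = \<xi> ` {1..n}"
        by (rule image_cong) simp_all
      ultimately have "inj_on (\<xi>(n + 1 := 0)) (insert (n + 1) {1..n})"
        using bij_betw_imp_inj_on[OF \<xi>] by (simp add: inj_on_insert del: fun_upd_apply) simp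
      then show ?thesis
        unfolding n(3) by (simp add: atLeastAtMostSuc_conv)
    qed
    moreover have "\<forall>l\<in>{1..g}. ((\<lambda>_. 2 / real n)(n + 1 := 1 / 32)) l > 0"
      using n(2) by simp
    ultimately show ?thesis
      unfolding n(3)
      by (intro exI[of _ "(\<lambda>_. 2 / real n)(n + 1 := 1 / 32)"] exI[of _ "\<xi>(n + 1 := 0)"] conjI)
        (simp_all add: mult.commute)
  qed
qed

lemma exists_planar_lens:
  assumes g: "g \<ge> 2"
  shows "\<exists>(c :: nat \<Rightarrow> real) (\<xi> :: nat \<Rightarrow> real ^ 2). inj_on \<xi> {1..g} \<and> (\<forall>l\<in>{1..g}. c l > 0) \<and>
    regular_fibre (- \<xi> ` {1..g}) (point_lens g c \<xi>) 0 (5 * g - 5)"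
proof -
  obtain c :: "nat \<Rightarrow> real" and \<xi> :: "nat \<Rightarrow> complex" where inj: "inj_on \<xi> {1..g}"
    and c: "\<forall>l\<in>{1..g}. c l > 0"
    and fib: "regular_fibre (- \<xi> ` {1..g}) (point_lens g c \<xi>) 0 (5 * g - 5)"
    using exists_complex_lens[OF g] by blast
  define T :: "complex \<Rightarrow> real ^ 2" where "T = (\<lambda>z. vector [Re z, Im z])"
  define S :: "real ^ 2 \<Rightarrow> complex" where "S = (\<lambda>v. Complex (v $ 1) (v $ 2))"
  have inv: "\<And>z. S (T z) = z" "\<And>v. T (S v) = v"
    by (simp_all add: S_def T_def Finite_Cartesian_Product.vec_eq_iff forall_2)
  have "linear T" "linear S"
    by (auto intro!: linearI simp: S_def T_def Finite_Cartesian_Product.vec_eq_iff forall_2 complex_eq_iff)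
  then have T: "linear T" "bounded_linear T" and S: "bounded_linear S"
    by (simp_all add: linear_conv_bounded_linear)
  have norm_T: "norm (T z) = 1 * norm z" for z
    by (simp add: T_def norm_vec_def L2_set_def sum_2 cmod_def)
  have eq: "point_lens g (\<lambda>l. 1\<^sup>2 * c l) (\<lambda>l. T (\<xi> l)) = (\<lambda>x. T (point_lens g c \<xi> (S x)))"
    by (rule ext) (rule point_lens_conjugate[OF T(1) inv(2) norm_T], simp)
  have bij: "bij T"
    by (metis inv bijI injI surjI)
  have poles: "- (\<lambda>l. T (\<xi> l)) ` {1..g} = T ` (- \<xi> ` {1..g})"
    by (simp add: bij_image_Compl_eq[OF bij] image_image)
  have "regular_fibre (- (\<lambda>l. T (\<xi> l)) ` {1..g}) (point_lens g (\<lambda>l. 1\<^sup>2 * c l) (\<lambda>l. T (\<xi> l))) (T 0) (5 * g - 5)"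
    unfolding poles eq by (rule regular_fibre_conjugate[OF T(2) S inv fib])
  then have "regular_fibre (- (\<lambda>l. T (\<xi> l)) ` {1..g}) (point_lens g c (\<lambda>l. T (\<xi> l))) 0 (5 * g - 5)"
    by (simp add: linear_0[OF T(1)])
  moreover have "inj_on (\<lambda>l. T (\<xi> l)) {1..g}"
    using comp_inj_on[OF inj inj_on_subset[OF bij_is_inj[OF bij] subset_UNIV]] by (simp add: comp_def)
  ultimately show ?thesis
    using c by blast
qed

section \<open>Rays through several planes\<close>

text \<open>The fictitious plane 0 carries the same point as plane 1, so that the first lens equation has
  the same shape as the others.\<close>

fun traj :: "(nat \<Rightarrow> 'a \<Rightarrow> 'a) \<Rightarrow> (nat \<Rightarrow> real) \<Rightarrow> 'a \<Rightarrow> nat \<Rightarrow> 'a::real_vector" where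
  "traj f e x 0 = x"
| "traj f e x (Suc 0) = x"
| "traj f e x (Suc (Suc n)) =
    f (Suc n) (traj f e x (Suc n)) + e (Suc n) *\<^sub>R (traj f e x (Suc n) - traj f e x n)"

lemma traj_cong:
  assumes "\<And>i. i \<in> {1..K} \<Longrightarrow> f i = f' i" "\<And>i. i \<in> {1..K} \<Longrightarrow> e i = e' i" "j \<le> Suc K"
  shows "traj f e x j = traj f' e' x j"
  using assms(3)
proof (induction j rule: less_induct)
  case (less j)
  consider "j = 0" | "j = Suc 0" | n where "j = Suc (Suc n)"
    by (metis not0_implies_Suc)
  then show ?case
  proof cases
    case 3
    then have "Suc n \<in> {1..K}"
      using less.prems by simp
    then show ?thesis
      using less.IH[of n] less.IH[of "Suc n"] less.prems assms(1,2)[of "Suc n"] unfolding 3 by simp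
  qed simp_all
qed

text \<open>Each lens equation is solved for the next point, so \<open>x 1\<close> determines the
  rest; writing \<open>y\<close> into place K + 1 lets the last equation be treated like the
  others.\<close>

lemma traj_unique:
  assumes K: "K \<ge> 1"
    and rec: "\<And>i. i \<in> {1..K} \<Longrightarrow>
      (x(K + 1 := y)) (i + 1) = f i (x i) + (if i = 1 then 0 else e i *\<^sub>R (x i - x (i - 1)))"
    and i: "i \<in> {1..K + 1}"
  shows "(x(K + 1 := y)) i = traj f e (x 1) i"
  using i
proof (induction i rule: less_induct)
  case (less i)
  consider "i = Suc 0" | "i = Suc (Suc 0)" | n where "i = Suc (Suc (Suc n))"
    using less.prems by (metis atLeastAtMost_iff not0_implies_Suc not_one_le_zero)
  then show ?case
  proof cases
    case 1
    then show ?thesis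
      using K by simp
  next
    case 2
    then show ?thesis
      using K rec[of 1] by simp
  next
    case 3
    have "(x(K + 1 := y)) i = f (n + 2) (x (n + 2)) + e (n + 2) *\<^sub>R (x (n + 2) - x (n + 1))"
      using rec[of "n + 2"] less.prems unfolding 3 by simp
    moreover have "x (n + 2) = traj f e (x 1) (n + 2)" "x (n + 1) = traj f e (x 1) (n + 1)"
      using less.IH[of "n + 2"] less.IH[of "n + 1"] less.prems unfolding 3 by auto
    ultimately show ?thesis
      unfolding 3 by simp
  qed
qed

text \<open>Apart from the maps \<open>f\<close> the recursion is linear, so its derivative is the
  same recursion with the \<open>F\<close>. Being again a \<open>traj\<close>, it can later be
  compared with kernel vectors by \<open>traj_unique\<close>.\<close>

lemma traj_has_derivative:
  fixes f :: "nat \<Rightarrow> 'a::real_normed_vector \<Rightarrow> 'a"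
  assumes "\<And>j. j \<in> {1..K} \<Longrightarrow> (f j has_derivative F j) (at (traj f e p j))" "i \<le> Suc K"
  shows "((\<lambda>p. traj f e p i) has_derivative (\<lambda>v. traj F e v i)) (at p)"
  using assms(2)
proof (induction i rule: less_induct)
  case (less i)
  consider "i = 0" | "i = Suc 0" | n where "i = Suc (Suc n)"
    by (metis not0_implies_Suc)
  then show ?case
  proof cases
    case 3
    have IH: "((\<lambda>p. traj f e p n) has_derivative (\<lambda>v. traj F e v n)) (at p)"
      "((\<lambda>p. traj f e p (Suc n)) has_derivative (\<lambda>v. traj F e v (Suc n))) (at p)"
      using less 3 by auto
    have "(f (Suc n) has_derivative F (Suc n)) (at (traj f e p (Suc n)))"
      using assms(1) less.prems 3 by simp
    from has_derivative_compose[OF IH(2) this] IH show ?thesis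
      unfolding 3 traj.simps by (intro derivative_intros) auto
  qed simp_all
qed

definition traj_domain ::
  "nat \<Rightarrow> (nat \<Rightarrow> 'a set) \<Rightarrow> (nat \<Rightarrow> 'a \<Rightarrow> 'a) \<Rightarrow> (nat \<Rightarrow> real) \<Rightarrow> 'a::real_vector set" where
  "traj_domain K P f e = {x. \<forall>j\<in>{1..K}. traj f e x j \<notin> P j}"

lemma traj_domain_Suc:
  "traj_domain (Suc K) P f e = {x \<in> traj_domain K P f e. traj f e x (Suc K) \<notin> P (Suc K)}"
  by (auto simp: traj_domain_def atLeastAtMostSuc_conv)

lemma controlled_ident: "controlled UNIV (\<lambda>x :: 'a::euclidean_space. x) (\<lambda>x. x)"
proof -
  have "{x :: 'a. norm x \<le> M} = cball 0 M" for M
    by auto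
  then have "compact {x :: 'a. norm x \<le> M}" for M
    by simp
  then show ?thesis
    unfolding controlled_def using C1_on_bounded_linear[OF bounded_linear_ident]
    by (auto intro: exI[of _ 0])
qed

text \<open>Properness and a disc of regular values, rather than one source, are what the induction
  must carry. The bound on \<open>e i\<close> is asked for all i so that distances can be fitted to
  the whole sequence afterwards.\<close>

lemma exists_lens_system:
  assumes "\<forall>i\<in>{1..K}. g i \<ge> 2"
  shows "\<exists>(c :: nat \<Rightarrow> nat \<Rightarrow> real) (\<xi> :: nat \<Rightarrow> nat \<Rightarrow> real ^ 2) e.
    (\<forall>i. 0 < e i \<and> e i \<le> 1 / 8) \<and>
    (\<forall>j\<in>{1..K}. inj_on (\<xi> j) {1..g j} \<and> (\<forall>l\<in>{1..g j}. c j l > 0)) \<and>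
    (let P = \<lambda>j. \<xi> j ` {1..g j}; f = \<lambda>j. point_lens (g j) (c j) (\<xi> j); D = traj_domain K P f e in
      controlled D (\<lambda>x. traj f e x K) (\<lambda>x. traj f e x (Suc K)) \<and>
      (\<exists>\<delta>>0. \<forall>y. norm y < \<delta> \<longrightarrow>
        regular_fibre D (\<lambda>x. traj f e x (Suc K)) y (\<Prod>i = 1..K. 5 * g i - 5)))"
  using assms
proof (induction K)
  case 0
  have "regular_at (\<lambda>x :: real ^ 2. x) x" for x
    by (rule regular_at_bounded_linear) (auto simp: inj_def)
  then have "regular_fibre UNIV (\<lambda>x :: real ^ 2. x) y 1" for y
    unfolding regular_fibre_def by simp
  then show ?case
    using controlled_ident
    by (intro exI[of _ "\<lambda>_ _. 0"] exI[of _ "\<lambda>_. 1 / 8"]) (auto simp: Let_def traj_domain_def intro!: exI[of _ "1 :: real"])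
next
  case (Suc K)
  then obtain c and \<xi> :: "nat \<Rightarrow> nat \<Rightarrow> real ^ 2" and e where e: "\<forall>i. 0 < e i \<and> e i \<le> 1 / 8"
    and c\<xi>: "\<forall>j\<in>{1..K}. inj_on (\<xi> j) {1..g j} \<and> (\<forall>l\<in>{1..g j}. c j l > 0)"
    and IH: "let P = \<lambda>j. \<xi> j ` {1..g j}; f = \<lambda>j. point_lens (g j) (c j) (\<xi> j); D = traj_domain K P f e in
      controlled D (\<lambda>x. traj f e x K) (\<lambda>x. traj f e x (Suc K)) \<and>
      (\<exists>\<delta>>0. \<forall>y. norm y < \<delta> \<longrightarrow>
        regular_fibre D (\<lambda>x. traj f e x (Suc K)) y (\<Prod>i = 1..K. 5 * g i - 5))"
    by force
  define P f where "P = (\<lambda>j. \<xi> j ` {1..g j})" and "f = (\<lambda>j. point_lens (g j) (c j) (\<xi> j))"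
  define D where "D = traj_domain K P f e"
  obtain \<delta> where ab: "controlled D (\<lambda>x. traj f e x K) (\<lambda>x. traj f e x (Suc K))" and \<delta>: "\<delta> > 0"
    and fib: "\<And>y. norm y < \<delta> \<Longrightarrow>
      regular_fibre D (\<lambda>x. traj f e x (Suc K)) y (\<Prod>i = 1..K. 5 * g i - 5)"
    using IH unfolding Let_def P_def[symmetric] f_def[symmetric] D_def[symmetric] by blast
  define m where "m = g (Suc K)"
  have "m \<ge> 2"
    using Suc.prems by (simp add: m_def)
  then obtain c1 and \<xi>1 :: "nat \<Rightarrow> real ^ 2" where lens1: "inj_on \<xi>1 {1..m}"
    "\<And>l. l \<in> {1..m} \<Longrightarrow> c1 l > 0"
    "regular_fibre (- \<xi>1 ` {1..m}) (point_lens m c1 \<xi>1) 0 (5 * m - 5)"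
    using exists_planar_lens[of m] by blast
  \<comment> \<open>The order of choice matters: the new lens is shrunk to fit the disc of radius
    \<delta>, and only then is its coupling \<open>e0\<close> made small.\<close>
  obtain c0 and \<xi>0 :: "nat \<Rightarrow> real ^ 2" where lens: "inj_on \<xi>0 {1..m}" "\<And>l. l \<in> {1..m} \<Longrightarrow> c0 l > 0"
    "regular_fibre (- \<xi>0 ` {1..m}) (point_lens m c0 \<xi>0) 0 (5 * m - 5)"
    and zeros: "\<And>z. z \<notin> \<xi>0 ` {1..m} \<Longrightarrow> point_lens m c0 \<xi>0 z = 0 \<Longrightarrow> norm z < \<delta>"
    by (rule point_lens_small_zeros[OF lens1 \<delta>]) blast+
  have like: "lens_like (\<xi>0 ` {1..m}) (point_lens m c0 \<xi>0)"
    using lens(1,2) by (rule lens_like_point_lens)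
  obtain e0 \<delta>' where e0: "0 < e0" "e0 \<le> 1 / 8" and \<delta>': "\<delta>' > 0"
    and fib': "\<And>y. norm y < \<delta>' \<Longrightarrow>
      regular_fibre {x\<in>D. traj f e x (Suc K) \<notin> \<xi>0 ` {1..m}}
        (\<lambda>x. point_lens m c0 \<xi>0 (traj f e x (Suc K)) +
          e0 *\<^sub>R (traj f e x (Suc K) - traj f e x K)) y ((5 * m - 5) * (\<Prod>i = 1..K. 5 * g i - 5))"
    using regular_fibre_step[OF ab like fib lens(3) zeros] by blast
  define c' \<xi>' e' where "c' = c(Suc K := c0)" and "\<xi>' = \<xi>(Suc K := \<xi>0)" and "e' = e(Suc K := e0)"
  define P' f' where "P' = (\<lambda>j. \<xi>' j ` {1..g j})" and "f' = (\<lambda>j. point_lens (g j) (c' j) (\<xi>' j))"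
  have traj': "traj f' e' x j = traj f e x j" if "j \<le> Suc K" for x j
    by (rule traj_cong[OF _ _ that]) (auto simp: f'_def f_def c'_def \<xi>'_def e'_def)
  have new: "P' (Suc K) = \<xi>0 ` {1..m}" "f' (Suc K) = point_lens m c0 \<xi>0" "e' (Suc K) = e0"
    by (simp_all add: P'_def f'_def c'_def \<xi>'_def e'_def m_def)
  have "traj_domain K P' f' e' = D"
    unfolding D_def traj_domain_def using traj' by (auto simp: P'_def P_def \<xi>'_def)
  then have dom: "traj_domain (Suc K) P' f' e' = {x\<in>D. traj f e x (Suc K) \<notin> \<xi>0 ` {1..m}}"
    unfolding traj_domain_Suc new using traj' by simp
  have last: "traj f' e' x (Suc (Suc K)) = point_lens m c0 \<xi>0 (traj f e x (Suc K)) +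
      e0 *\<^sub>R (traj f e x (Suc K) - traj f e x K)" for x
    by (simp add: traj' new)
  have "controlled (traj_domain (Suc K) P' f' e') (\<lambda>x. traj f' e' x (Suc K)) (\<lambda>x. traj f' e' x (Suc (Suc K)))"
    using controlled_step[OF ab like, of e0] e0 unfolding dom last traj'[OF order_refl] by simp
  moreover have "\<exists>\<delta>>0. \<forall>y. norm y < \<delta> \<longrightarrow> regular_fibre (traj_domain (Suc K) P' f' e')
      (\<lambda>x. traj f' e' x (Suc (Suc K))) y (\<Prod>i = 1..Suc K. 5 * g i - 5)"
    using fib' \<delta>' unfolding dom last by (auto simp: m_def mult.commute)
  moreover have "\<forall>i. 0 < e' i \<and> e' i \<le> 1 / 8"
    using e e0 by (simp add: e'_def)
  moreover have "\<forall>j\<in>{1..Suc K}. inj_on (\<xi>' j) {1..g j} \<and> (\<forall>l\<in>{1..g j}. c' j l > 0)"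
    using c\<xi> lens(1,2) by (auto simp: \<xi>'_def c'_def m_def)
  ultimately show ?case
    unfolding Let_def by (intro exI[of _ c'] exI[of _ \<xi>'] exI[of _ e'])
      (simp only: P'_def[symmetric] f'_def[symmetric] simp_thms)
qed

section \<open>Distances, and the Jacobian matrix\<close>

text \<open>In terms of \<open>q\<^sub>i = 1 / d\<^sub>i\<close> the constants are \<open>\<epsilon>\<^sub>i = (q\<^sub>i - q\<^sub>i\<^sub>+\<^sub>1) / (q\<^sub>i\<^sub>-\<^sub>1 - q\<^sub>i)\<close>,
  so prescribed values of at most 1/8 are realised by a decreasing sequence that stays positive.\<close>

lemma exists_distances:
  fixes e :: "nat \<Rightarrow> real"
  assumes e: "\<And>i. 0 < e i" "\<And>i. e i \<le> 1 / 8"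
  obtains d where "0 < d 1" "strict_mono_on {1..} d" "\<And>i. i \<ge> 1 \<Longrightarrow> beta d i > 0"
    "\<And>i. i \<ge> 2 \<Longrightarrow> eps d i = e i"
proof -
  \<comment> \<open>\<open>w i\<close> is the difference q_i - q_(i+1); successive differences have
    ratio e_i, and the empty product gives \<open>w 1 = 1\<close>.\<close>
  define w where "w = (\<lambda>i. \<Prod>k = 2..i. e k)"
  define q where "q = (\<lambda>i. 3 - (\<Sum>j = 1..<i. w j))"
  define d where "d = (\<lambda>i. 1 / q i)"
  have w: "w i > 0" for i
    using e(1) by (simp add: w_def prod_pos)
  have w_Suc: "w (Suc i) = e (Suc i) * w i" if "i \<ge> 1" for i
    using that by (simp add: w_def mult.commute)
  have q_Suc: "q (Suc i) = q i - w i" if "i \<ge> 1" for i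
    using that by (simp add: q_def)
  \<comment> \<open>The differences shrink at least by the factor 8, so they sum to at most 2, and
    the start value 3 keeps \<open>q\<close> positive.\<close>
  have bound: "(\<Sum>j = 1..<i. w j) + 2 * w i \<le> 2" if "i \<ge> 1" for i
    using that
  proof (induction i rule: dec_induct)
    case base
    then show ?case
      by (simp add: w_def)
  next
    case (step i)
    have "w (Suc i) \<le> 1 / 8 * w i"
      using w_Suc[OF step.hyps(1)] e(2) w[of i] by simp
    then show ?case
      using step w[of i] by simp
  qed
  have q_pos: "q i > 0" if "i \<ge> 1" for i
    using bound[OF that] w[of i] by (simp add: q_def)
  have d_less: "d i < d (Suc i)" if "i \<ge> 1" for i
    using that q_pos[of "Suc i"] q_Suc w[of i] by (auto simp: d_def intro!: divide_strict_left_mono)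
  have d_pos: "d i > 0" if "i \<ge> 1" for i
    using q_pos[OF that] by (simp add: d_def)
  have mono: "d i < d j" if "1 \<le> i" "i < j" for i j
    using that(2,1) by (induction i j rule: less_Suc_induct) (auto simp: d_less intro: less_trans)
  show thesis
  proof (rule that[of d])
    show "0 < d 1"
      by (rule d_pos) simp
    show "strict_mono_on {1..} d"
      using mono by (intro strict_mono_onI) auto
    show "beta d i > 0" if "i \<ge> 1" for i
      using d_less[OF that] d_pos[of "Suc i"] by (simp add: beta_def)
    fix i :: nat assume "i \<ge> 2"
    then obtain k where i: "i = Suc k" "k \<ge> 1"
      by (cases i) auto
    have q: "q k > 0" "q (Suc k) > 0" "q (Suc (Suc k)) > 0"
      using q_pos i(2) by auto
    have "eps d i = (d k * (d (Suc (Suc k)) - d (Suc k))) / ((d (Suc k) - d k) * d (Suc (Suc k)))"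
      using eps_altdef[of d i] d_less[OF i(2)] d_pos[of "Suc (Suc k)"] unfolding i by simp
    also have "\<dots> = (q (Suc k) - q (Suc (Suc k))) / (q k - q (Suc k))"
      unfolding d_def using q by (cases "q k = q (Suc k)") (simp_all add: field_simps)
    also have "\<dots> = e i"
      using q_Suc[of k] q_Suc[of "Suc k"] w_Suc[of k] w[of k] i by simp
    finally show "eps d i = e i" .
  qed
qed

section \<open>From the ray map back to the lens system in coordinates\<close>

lemma inj_of_nat_component:
  "of_nat (c mod 2 + 1) = (of_nat (c' mod 2 + 1) :: 2) \<longleftrightarrow> c mod 2 = c' mod 2"
proof -
  have "c mod 2 = 0 \<or> c mod 2 = 1" "c' mod 2 = 0 \<or> c' mod 2 = 1"
    by auto
  moreover have "(1 :: 2) \<noteq> 2"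
    by simp
  ultimately show ?thesis
    by auto
qed

definition coord_axis :: "nat \<Rightarrow> nat \<Rightarrow> real ^ 2" where
  "coord_axis c i = (if i = c div 2 + 1 then axis (of_nat (c mod 2 + 1)) 1 else 0)"

lemma shift_coord_eq: "shift_coord x c t i = x i + t *\<^sub>R coord_axis c i"
  by (simp add: shift_coord_def coord_axis_def)

lemma coord_sum_coord_axis:
  assumes "c < n"
  shows "coord (\<lambda>i. \<Sum>c'<n. v c' *\<^sub>R coord_axis c' i) c = v c"
proof -
  have "coord (\<lambda>i. \<Sum>c'<n. v c' *\<^sub>R coord_axis c' i) c = (\<Sum>c'<n. if c' = c then v c' else 0)"
    unfolding coord_def sum_component
  proof (rule sum.cong)
    fix c' assume "c' \<in> {..<n}"
    have "c' div 2 = c div 2 \<and> c' mod 2 = c mod 2 \<longleftrightarrow> c' = c"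
      by (metis div_mult_mod_eq)
    then show "(v c' *\<^sub>R coord_axis c' (c div 2 + 1)) $ of_nat (c mod 2 + 1) = (if c' = c then v c' else 0)"
      using inj_of_nat_component[of c c'] by (auto simp: coord_axis_def axis_def simp del: of_nat_add of_nat_Suc)
  qed simp
  also have "\<dots> = v c"
    using assms by simp
  finally show ?thesis .
qed

definition traj_point ::
  "nat \<Rightarrow> (nat \<Rightarrow> 'a \<Rightarrow> 'a) \<Rightarrow> (nat \<Rightarrow> real) \<Rightarrow> 'a \<Rightarrow> nat \<Rightarrow> 'a::real_vector" where
  "traj_point K f e p = (\<lambda>i\<in>{1..K}. traj f e p i)"

lemma inj_traj_point:
  assumes "K \<ge> 1"
  shows "inj (traj_point K f e)"
proof (rule injI)
  fix p p' assume "traj_point K f e p = traj_point K f e p'"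
  from fun_cong[OF this, of 1] show "p = p'"
    using assms by (simp add: traj_point_def)
qed

context
  fixes K :: nat and g :: "nat \<Rightarrow> nat" and d :: "nat \<Rightarrow> real" and b :: "nat \<Rightarrow> nat \<Rightarrow> real"
    and \<xi> :: "nat \<Rightarrow> nat \<Rightarrow> real ^ 2" and f :: "nat \<Rightarrow> real ^ 2 \<Rightarrow> real ^ 2" and e :: "nat \<Rightarrow> real"
    and P :: "nat \<Rightarrow> (real ^ 2) set" and y :: "real ^ 2"
  assumes K: "K \<ge> 1"
    and P: "\<And>i. P i = \<xi> i ` {1..g i}"
    and f: "\<And>i z. i \<in> {1..K} \<Longrightarrow> f i z = z - beta d i *\<^sub>R alpha (g i) (b i) (\<xi> i) z"
    and e: "\<And>i. i \<in> {2..K} \<Longrightarrow> e i = eps d i"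
begin

lemma ray_eq:
  assumes "i \<in> {1..K}"
  shows "ray g d b \<xi> x i = f i (x i) + (if i = 1 then 0 else e i *\<^sub>R (x i - x (i - 1)))"
  using assms f[of i] e[of i] by (auto simp: ray_def)

text \<open>Reading the equations forwards, a solution is the ray of its first point, and the last
  equation says that this ray ends at \<open>y\<close>. The restriction in \<open>traj_point\<close>
  matches the extensional functions of \<open>lens_domain\<close>.\<close>

lemma lens_solutions_eq_image:
  "lens_solutions K g d b \<xi> y = traj_point K f e ` {p \<in> traj_domain K P f e. traj f e p (Suc K) = y}"
proof (intro equalityI subsetI)
  fix x assume x: "x \<in> lens_solutions K g d b \<xi> y"
  have rec: "(x(K + 1 := y)) (i + 1) = f i (x i) + (if i = 1 then 0 else e i *\<^sub>R (x i - x (i - 1)))"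
    if "i \<in> {1..K}" for i
    using x ray_eq[OF that] that unfolding lens_solutions_def by auto
  note traj = traj_unique[OF K, where x = x and y = y and f = f and e = e, OF rec]
  have x_eq: "x i = traj f e (x 1) i" if "i \<in> {1..K}" for i
    using traj[of i] that by auto
  have dom: "x \<in> {1..K} \<rightarrow>\<^sub>E UNIV" "\<And>j. j \<in> {1..K} \<Longrightarrow> x j \<notin> P j"
    using x unfolding lens_solutions_def lens_domain_def P by auto
  have "x = traj_point K f e (x 1)"
  proof (rule ext)
    fix i
    show "x i = traj_point K f e (x 1) i"
      using x_eq[of i] PiE_arb[OF dom(1), of i] by (simp only: traj_point_def restrict_def split: if_split) blast
  qed
  moreover have "x 1 \<in> traj_domain K P f e"
    unfolding traj_domain_def
  proof (intro CollectI ballI)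
    fix j assume j: "j \<in> {1..K}"
    show "traj f e (x 1) j \<notin> P j"
      using dom(2)[OF j] by (simp only: x_eq[OF j, symmetric] not_False_eq_True)
  qed
  moreover have "traj f e (x 1) (Suc K) = y"
    using traj[of "K + 1"] by simp
  ultimately show "x \<in> traj_point K f e ` {p \<in> traj_domain K P f e. traj f e p (Suc K) = y}"
    by blast
next
  fix x assume "x \<in> traj_point K f e ` {p \<in> traj_domain K P f e. traj f e p (Suc K) = y}"
  then obtain p where x: "x = traj_point K f e p" and p: "p \<in> traj_domain K P f e" "traj f e p (Suc K) = y"
    by blast
  have x_eq: "x i = traj f e p i" if "i \<in> {1..K}" for i
    using that by (simp add: x traj_point_def)
  have "x \<in> lens_domain K g \<xi>"
  proof -
    have "x \<in> {1..K} \<rightarrow>\<^sub>E UNIV"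
      by (simp add: x traj_point_def)
    moreover have "x j \<notin> \<xi> j ` {1..g j}" if "j \<in> {1..K}" for j
      using p(1) that x_eq[OF that] unfolding traj_domain_def P by simp
    ultimately show ?thesis
      unfolding lens_domain_def by blast
  qed
  moreover have "(x(K + 1 := y)) (i + 1) = ray g d b \<xi> x i" if i: "i \<in> {1..K}" for i
  proof -
    have "(x(K + 1 := y)) (i + 1) = traj f e p (i + 1)"
      using i p(2) x_eq[of "i + 1"] by auto
    moreover obtain n where n: "i = Suc n"
      using i by (cases i) auto
    moreover have "traj f e p (Suc (Suc n)) =
        f i (x i) + (if i = 1 then 0 else e i *\<^sub>R (x i - x (i - 1)))"
      using x_eq[OF i] x_eq[of n] i unfolding n by (cases n) auto
    ultimately show ?thesis
      using ray_eq[OF i] by simp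
  qed
  ultimately show "x \<in> lens_solutions K g d b \<xi> y"
    unfolding lens_solutions_def by blast
qed

text \<open>A kernel vector of the Jacobian matrix satisfies the linearised lens equations, so it is
  the derivative of the ray in the direction of its first component.\<close>

lemma det_jacobian_nonzero:
  assumes C1: "\<And>i. i \<in> {1..K} \<Longrightarrow> C1_on (- P i) (f i)"
    and p: "p \<in> traj_domain K P f e" and reg: "regular_at (\<lambda>p. traj f e p (Suc K)) p"
  shows "Determinant.det (jacobian_matrix K (lens_map K g d b \<xi> y) (traj_point K f e p)) \<noteq> 0"
proof
  define x where "x = traj_point K f e p"
  define J where "J = jacobian_matrix K (lens_map K g d b \<xi> y) x"
  assume "Determinant.det (jacobian_matrix K (lens_map K g d b \<xi> y) (traj_point K f e p)) = 0"
  then have det0: "Determinant.det J = 0"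
    by (simp add: J_def x_def)
  have J: "J \<in> carrier_mat (2 * K) (2 * K)"
    by (simp add: J_def jacobian_matrix_def)
  have x_eq: "x i = traj f e p i" if "i \<in> {1..K}" for i
    using that by (simp add: x_def traj_point_def)
  have "\<exists>F. (f i has_derivative F) (at (traj f e p i))" if "i \<in> {1..K}" for i
    using C1_on_imp_has_derivative[OF C1[OF that]] p that unfolding traj_domain_def by auto
  then obtain F where F: "\<And>i. i \<in> {1..K} \<Longrightarrow> (f i has_derivative F i) (at (traj f e p i))"
    by metis
  have lin_F: "linear (F i)" if "i \<in> {1..K}" for i
    using F[OF that] by (rule has_derivative_linear)
  \<comment> \<open>\<open>L\<close> is the derivative of the lens map at \<open>x\<close>; for i =
    K the next point is the fixed \<open>y\<close>, whence the 0.\<close>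
  define L where "L = (\<lambda>u i. (if i = K then 0 else u (i + 1)) -
    (F i (u i) + (if i = 1 then 0 else e i *\<^sub>R (u i - u (i - 1)))))"
  have entry: "J $$ (r, c) = coord (L (coord_axis c)) r" if r: "r < 2 * K" and c: "c < 2 * K" for r c
  proof -
    define i where "i = r div 2 + 1"
    have i: "i \<in> {1..K}"
      using r by (auto simp: i_def)
    let ?X = "\<lambda>t. shift_coord x c t"
    have "((\<lambda>t. x j + t *\<^sub>R coord_axis c j) has_derivative (\<lambda>h. h *\<^sub>R coord_axis c j)) (at 0)" for j
      by (auto intro!: derivative_eq_intros)
    then have X: "((\<lambda>t. ?X t j) has_derivative (\<lambda>h. h *\<^sub>R coord_axis c j)) (at 0)" for j
      by (simp add: shift_coord_eq)
    have FX: "((\<lambda>t. f i (?X t i)) has_derivative (\<lambda>h. F i (h *\<^sub>R coord_axis c i))) (at 0)"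
    proof (rule has_derivative_compose[OF X])
      show "(f i has_derivative F i) (at (?X 0 i))"
        using F[OF i] x_eq[OF i] by (simp add: shift_coord_eq)
    qed
    have next_X: "((\<lambda>t. if i = K then y else ?X t (i + 1)) has_derivative
        (\<lambda>h. if i = K then 0 else h *\<^sub>R coord_axis c (i + 1))) (at 0)"
      using X[of "i + 1"] by (cases "i = K") auto
    have prev_X: "((\<lambda>t. if i = 1 then 0 else e i *\<^sub>R (?X t i - ?X t (i - 1))) has_derivative
        (\<lambda>h. if i = 1 then 0 else e i *\<^sub>R (h *\<^sub>R coord_axis c i - h *\<^sub>R coord_axis c (i - 1)))) (at 0)"
      using has_derivative_scaleR_right[OF has_derivative_diff[OF X X], of "e i"] by (cases "i = 1") auto
    have map_eq: "lens_map K g d b \<xi> y (?X t) i = (if i = K then y else ?X t (i + 1)) -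
        (f i (?X t i) + (if i = 1 then 0 else e i *\<^sub>R (?X t i - ?X t (i - 1))))" for t
      using i ray_eq[OF i] unfolding lens_map_def by auto
    have "((\<lambda>t. lens_map K g d b \<xi> y (?X t) i) has_derivative (\<lambda>h.
        (if i = K then 0 else h *\<^sub>R coord_axis c (i + 1)) - (F i (h *\<^sub>R coord_axis c i) +
          (if i = 1 then 0 else e i *\<^sub>R (h *\<^sub>R coord_axis c i - h *\<^sub>R coord_axis c (i - 1)))))) (at 0)"
      unfolding map_eq by (rule has_derivative_diff[OF next_X has_derivative_add[OF FX prev_X]])
    moreover have "(if i = K then 0 else h *\<^sub>R coord_axis c (i + 1)) - (F i (h *\<^sub>R coord_axis c i) +
          (if i = 1 then 0 else e i *\<^sub>R (h *\<^sub>R coord_axis c i - h *\<^sub>R coord_axis c (i - 1)))) =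
        h *\<^sub>R L (coord_axis c) i" for h
      unfolding L_def linear_scale[OF lin_F[OF i]] by (simp add: algebra_simps)
    ultimately have "((\<lambda>t. lens_map K g d b \<xi> y (?X t) i) has_derivative (\<lambda>h. h *\<^sub>R L (coord_axis c) i)) (at 0)"
      by (simp only:)
    from bounded_linear.has_derivative[OF bounded_linear_vec_nth this, of "of_nat (r mod 2 + 1)"]
    have "((\<lambda>t. coord (lens_map K g d b \<xi> y (?X t)) r) has_field_derivative coord (L (coord_axis c)) r) (at 0)"
      unfolding has_field_derivative_def coord_def i_def[symmetric] by (simp add: mult.commute[of _ "L _ _ $ _"])
    then have "deriv (\<lambda>t. coord (lens_map K g d b \<xi> y (?X t)) r) 0 = coord (L (coord_axis c)) r"
      by (rule DERIV_imp_deriv)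
    then show ?thesis
      using r c unfolding J_def jacobian_matrix_def by simp
  qed
  obtain v where v: "v \<in> carrier_vec (2 * K)" "v \<noteq> 0\<^sub>v (2 * K)" "J *\<^sub>v v = 0\<^sub>v (2 * K)"
    using det_0_iff_vec_prod_zero[OF J] det0 by blast
  \<comment> \<open>The 2 K coordinates of the kernel vector are regrouped into one planar vector
    per plane.\<close>
  define w where "w = (\<lambda>i. \<Sum>c<2 * K. vec_index v c *\<^sub>R coord_axis c i)"
  have L_w: "L w i = (\<Sum>c<2 * K. vec_index v c *\<^sub>R L (coord_axis c) i)" if "i \<in> {1..K}" for i
    unfolding L_def w_def linear_sum[OF lin_F[OF that]] linear_scale[OF lin_F[OF that]]
    by (simp add: scaleR_diff_right scaleR_add_right sum_subtractf sum.distrib scaleR_sum_right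
        mult.commute)
  have L_w_0: "L w i = 0" if i: "i \<in> {1..K}" for i
  proof -
    have "coord (L w) r = 0" if r: "r < 2 * K" "r div 2 + 1 = i" for r
    proof -
      have "coord (L w) r = (\<Sum>c<2 * K. vec_index v c * coord (L (coord_axis c)) r)"
        using L_w[OF i] r(2) by (simp add: coord_def sum_component)
      also have "\<dots> = (\<Sum>c<2 * K. J $$ (r, c) * vec_index v c)"
        using entry[OF r(1)] by (intro sum.cong) auto
      also have "\<dots> = vec_index (J *\<^sub>v v) r"
        using J v(1) r(1) by (simp add: scalar_prod_def lessThan_atLeast0)
      also have "\<dots> = 0"
        using v(3) r(1) by simp
      finally show ?thesis .
    qed
    from this[of "2 * (i - 1)"] this[of "2 * (i - 1) + 1"] have "L w i $ 1 = 0" "L w i $ 2 = 0"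
      using i by (auto simp: coord_def)
    then show ?thesis
      by (simp add: Finite_Cartesian_Product.vec_eq_iff forall_2)
  qed
  \<comment> \<open>The kernel condition is the linearised recursion, with end value 0 in place of
    \<open>y\<close>.\<close>
  have rec: "(w(K + 1 := 0)) (i + 1) = F i (w i) + (if i = 1 then 0 else e i *\<^sub>R (w i - w (i - 1)))"
    if "i \<in> {1..K}" for i
    using L_w_0[OF that] that unfolding L_def by (auto split: if_splits)
  note w_traj = traj_unique[OF K, where x = w and y = 0 and f = F and e = e, OF rec]
  have der: "((\<lambda>p. traj f e p i) has_derivative (\<lambda>v. traj F e v i)) (at p)" if "i \<le> Suc K" for i
    using F that by (rule traj_has_derivative)
  have traj_0: "traj F e 0 i = 0" if "i \<le> Suc K" for i
    using linear_0[OF has_derivative_linear[OF der[OF that]]] .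
  \<comment> \<open>By \<open>reg\<close>, no nonzero variation of the first point leaves the end of
    the ray fixed to first order.\<close>
  have "inj (\<lambda>v. traj F e v (Suc K))"
    using reg has_derivative_unique[OF der[OF order_refl]] unfolding regular_at_def by metis
  moreover have "traj F e (w 1) (Suc K) = traj F e 0 (Suc K)"
    using w_traj[of "K + 1"] traj_0[of "Suc K"] by simp
  ultimately have "w 1 = 0"
    by (rule injD)
  then have w_0: "w i = 0" if "i \<in> {1..K}" for i
    using w_traj[of i] traj_0[of i] that by auto
  have "vec_index v c = 0" if "c < 2 * K" for c
  proof -
    have "vec_index v c = coord w c"
      unfolding w_def using coord_sum_coord_axis[OF that] by simp
    also have "\<dots> = 0"
      using w_0[of "c div 2 + 1"] that by (simp add: coord_def)
    finally show ?thesis .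
  qed
  then have "v = 0\<^sub>v (2 * K)"
    using v(1) by (intro eq_vecI) auto
  with v(2) show False
    by blast
qed

end

theorem theoremI3:
  fixes K :: nat and g :: "nat \<Rightarrow> nat"
  assumes "K \<ge> 1" and "\<forall>i\<in>{1..K}. g i \<ge> 2"
  shows "\<exists>(d :: nat \<Rightarrow> real) (b :: nat \<Rightarrow> nat \<Rightarrow> real) (\<xi> :: nat \<Rightarrow> nat \<Rightarrow> real ^ 2) (y :: real ^ 2).
    0 < d 1 \<and> strict_mono_on {1..K + 1} d \<and>
    (\<forall>i\<in>{1..K}. beta d i > 0) \<and> (\<forall>i\<in>{2..K}. eps d i > 0) \<and>
    (\<forall>j\<in>{1..K}. \<forall>l\<in>{1..g j}. b j l > 0) \<and>
    (\<forall>j\<in>{1..K}. inj_on (\<xi> j) {1..g j}) \<and>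
    nondegenerate K g d b \<xi> y \<and>
    finite (lens_solutions K g d b \<xi> y) \<and>
    card (lens_solutions K g d b \<xi> y) = (\<Prod>i = 1..K. 5 * g i - 5)"
proof -
  obtain c and \<xi> :: "nat \<Rightarrow> nat \<Rightarrow> real ^ 2" and e where e: "\<forall>i. 0 < e i \<and> e i \<le> 1 / 8"
    and c\<xi>: "\<forall>j\<in>{1..K}. inj_on (\<xi> j) {1..g j} \<and> (\<forall>l\<in>{1..g j}. c j l > 0)"
    and sys: "let P = \<lambda>j. \<xi> j ` {1..g j}; f = \<lambda>j. point_lens (g j) (c j) (\<xi> j); D = traj_domain K P f e in
      controlled D (\<lambda>x. traj f e x K) (\<lambda>x. traj f e x (Suc K)) \<and>
      (\<exists>\<delta>>0. \<forall>y. norm y < \<delta> \<longrightarrow>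
        regular_fibre D (\<lambda>x. traj f e x (Suc K)) y (\<Prod>i = 1..K. 5 * g i - 5))"
    using exists_lens_system[OF assms(2)] by blast
  define P f where "P = (\<lambda>j. \<xi> j ` {1..g j})" and "f = (\<lambda>j. point_lens (g j) (c j) (\<xi> j))"
  \<comment> \<open>The source is placed at the centre of the disc of regular values.\<close>
  have fib: "regular_fibre (traj_domain K P f e) (\<lambda>x. traj f e x (Suc K)) 0 (\<Prod>i = 1..K. 5 * g i - 5)"
    using sys unfolding Let_def P_def[symmetric] f_def[symmetric] by force
  obtain d where d: "0 < d 1" "strict_mono_on {1..} d" "\<And>i. i \<ge> 1 \<Longrightarrow> beta d i > 0"
    "\<And>i. i \<ge> 2 \<Longrightarrow> eps d i = e i"
    using exists_distances[of e] e by blast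
  \<comment> \<open>The weights \<open>c\<close> were chosen without reference to distances; these
    radii make \<beta> times the squared radius equal to \<open>c\<close>.\<close>
  define b where "b = (\<lambda>j l. sqrt (c j l / beta d j))"
  have b: "b j l > 0" "beta d j * (b j l)\<^sup>2 = c j l" if "j \<in> {1..K}" "l \<in> {1..g j}" for j l
  proof -
    have pos: "c j l > 0" "beta d j > 0"
      using c\<xi> d(3)[of j] that by auto
    then show "b j l > 0"
      by (simp add: b_def)
    have "(b j l)\<^sup>2 = c j l / beta d j"
      using pos by (simp only: b_def real_sqrt_pow2 divide_nonneg_pos less_imp_le)
    then show "beta d j * (b j l)\<^sup>2 = c j l"
      using pos by simp
  qed
  have f: "f i z = z - beta d i *\<^sub>R alpha (g i) (b i) (\<xi> i) z" if "i \<in> {1..K}" for i z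
  proof -
    have "beta d i *\<^sub>R alpha (g i) (b i) (\<xi> i) z =
        (\<Sum>l = 1..g i. (beta d i * (b i l)\<^sup>2) *\<^sub>R ((z - \<xi> i l) /\<^sub>R (norm (z - \<xi> i l))\<^sup>2))"
      unfolding alpha_def by (simp only: scaleR_sum_right scaleR_scaleR mult.assoc)
    also have "\<dots> = (\<Sum>l = 1..g i. c i l *\<^sub>R ((z - \<xi> i l) /\<^sub>R (norm (z - \<xi> i l))\<^sup>2))"
      by (intro sum.cong refl) (simp only: b(2)[OF that])
    finally show ?thesis
      unfolding f_def point_lens_def by simp
  qed
  have P: "P i = \<xi> i ` {1..g i}" for i
    by (simp add: P_def)
  have e': "e i = eps d i" if "i \<in> {2..K}" for i
    using d(4)[of i] that by simp
  have C1: "C1_on (- P i) (f i)" for i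
    unfolding P_def f_def by (rule C1_on_point_lens)
  have solutions: "lens_solutions K g d b \<xi> 0 =
      traj_point K f e ` {p \<in> traj_domain K P f e. traj f e p (Suc K) = 0}"
    by (rule lens_solutions_eq_image[OF assms(1) P f e'])
  have "Determinant.det (jacobian_matrix K (lens_map K g d b \<xi> 0) (traj_point K f e p)) \<noteq> 0"
    if "p \<in> traj_domain K P f e" "traj f e p (Suc K) = 0" for p
  proof -
    have "regular_at (\<lambda>p. traj f e p (Suc K)) p"
      using fib that unfolding regular_fibre_def by blast
    with that(1) show ?thesis
      by (rule det_jacobian_nonzero[OF assms(1) P f e' C1, rotated -2])
  qed
  then have "nondegenerate K g d b \<xi> 0"
    unfolding nondegenerate_def solutions by blast
  moreover have "finite (lens_solutions K g d b \<xi> 0)"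
    using fib unfolding solutions regular_fibre_def by simp
  moreover have "card (lens_solutions K g d b \<xi> 0) = (\<Prod>i = 1..K. 5 * g i - 5)"
  proof -
    have "card (lens_solutions K g d b \<xi> 0) = card {p \<in> traj_domain K P f e. traj f e p (Suc K) = 0}"
      unfolding solutions
      by (rule card_image) (rule inj_on_subset[OF inj_traj_point[OF assms(1)] subset_UNIV])
    also have "\<dots> = (\<Prod>i = 1..K. 5 * g i - 5)"
      using fib unfolding regular_fibre_def by blast
    finally show ?thesis .
  qed
  moreover have "strict_mono_on {1..K + 1} d"
    using d(2) by (rule monotone_on_subset) auto
  ultimately show ?thesis
    using d b(1) c\<xi> e by (intro exI[of _ d] exI[of _ b] exI[of _ \<xi>] exI[of _ 0]) auto
qed

end
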